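(* Let $n\ge 1$ and let $k_1,\dots,k_I$ be positive integers with $k_1+\cdots+k_I=n$. The set of all unitary $n\times n$ matrices which have exactly $I$ distinct eigenvalues, with multiplicities $k_1,\dots,k_I$ (the values of the eigenvalues being otherwise unrestricted), has real dimension $$n^2-\sum_{i=1}^I (k_i^2-1).$$
   Context: A complex $n\times n$ matrix $A$ is unitary if $AA^\ast$ is the identity, where $A^\ast$ is the adjoint (conjugate transpose). "Real dimension" of a subset of the space of complex $n\times n$ matrices is the usual dimension over $\mathbb R$ (of a real manifold, or of a semialgebraic set). *)

theory Defs
  imports "HOL-Analysis.Analysis" "HOL-Computational_Algebra.Polynomial"
begin

definition conj_transpose :: "complex ^ 'n ^ 'm \<Rightarrow> complex ^ 'm ^ 'n" where
  "conj_transpose A = (\<chi> i j. cnj (A $ j $ i))"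

definition unitary_matrix :: "complex ^ 'n ^ 'n \<Rightarrow> bool" where
  "unitary_matrix A \<longleftrightarrow> A ** conj_transpose A = mat 1"

definition eigenvalue :: "complex ^ 'n ^ 'n \<Rightarrow> complex \<Rightarrow> bool" where
  "eigenvalue A z \<longleftrightarrow> (\<exists>v. v \<noteq> 0 \<and> A *v v = z *s v)"

definition charpoly :: "complex ^ 'n ^ 'n \<Rightarrow> complex poly" where
  "charpoly A = det (\<chi> i j. (if i = j then [:0, 1:] else 0) - [:A $ i $ j:])"

definition multiplicity_eigenvalue :: "complex ^ 'n ^ 'n \<Rightarrow> complex \<Rightarrow> nat" where
  "multiplicity_eigenvalue A z = order z (charpoly A)"

text \<open>The labelling \<open>l\<close> of the eigenvalues is existentially quantified, so only the multiset
  of the multiplicities matters, not their order.\<close>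

definition unitary_with_multiplicities :: "nat \<Rightarrow> (nat \<Rightarrow> nat) \<Rightarrow> (complex ^ 'n ^ 'n) set" where
  "unitary_with_multiplicities I k =
     {A. unitary_matrix A \<and>
         (\<exists>l :: nat \<Rightarrow> complex. inj_on l {1..I} \<and> {z. eigenvalue A z} = l ` {1..I} \<and>
            (\<forall>i\<in>{1..I}. multiplicity_eigenvalue A (l i) = k i))}"

text \<open>In \<open>C_k_on k W f\<close> all iterated directional derivatives of order at most \<open>k\<close> exist and are
  continuous on \<open>W\<close>. On an open set \<open>W\<close> of a Euclidean space this is the usual class \<open>C\<^sup>k\<close>.
  All derivatives are over the reals.\<close>

primrec C_k_on :: "nat \<Rightarrow> 'a::euclidean_space set \<Rightarrow> ('a \<Rightarrow> 'b::euclidean_space) \<Rightarrow> bool" where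
  "C_k_on 0 W f \<longleftrightarrow> continuous_on W f"
| "C_k_on (Suc k) W f \<longleftrightarrow> (\<forall>x\<in>W. f differentiable (at x)) \<and>
     (\<forall>v. C_k_on k W (\<lambda>x. frechet_derivative f (at x) v))"

definition C_infinity_on :: "'a::euclidean_space set \<Rightarrow> ('a \<Rightarrow> 'b::euclidean_space) \<Rightarrow> bool" where
  "C_infinity_on W f \<longleftrightarrow> (\<forall>k. C_k_on k W f)"

text \<open>Embedded smooth submanifolds of dimension \<open>d\<close>, given by local parametrisations: every point
  of \<open>M\<close> has a neighbourhood in \<open>M\<close> that is the image of an open subset of a \<open>d\<close>-dimensional
  vector space under a smooth homeomorphism with injective differential. As \<open>d\<close> is a
  number and not a type, a \<open>d\<close>-dimensional real linear subspace \<open>L\<close> of the ambient space takes the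
  place of the space of \<open>d\<close>-tuples; its open subsets are the sets \<open>W \<inter> L\<close> with \<open>W\<close> open. Asking that
  \<open>f\<close> be smooth on \<open>W\<close> is no restriction, since a smooth map on an open subset of \<open>L\<close> extends by
  composition with the orthogonal projection onto \<open>L\<close>.\<close>

definition smooth_submanifold :: "nat \<Rightarrow> 'a::euclidean_space set \<Rightarrow> bool" where
  "smooth_submanifold d M \<longleftrightarrow>
     (\<forall>p\<in>M. \<exists>U L W f g. open U \<and> p \<in> U \<and> subspace L \<and> dim L = d \<and> open W \<and>
        C_infinity_on W (f :: 'a \<Rightarrow> 'a) \<and> homeomorphism (W \<inter> L) (M \<inter> U) f g \<and>
        (\<forall>x \<in> W \<inter> L. inj_on (frechet_derivative f (at x)) L))"

text \<open>The empty set is excluded, because it is a submanifold of every dimension.\<close>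

definition has_real_dimension :: "'a::euclidean_space set \<Rightarrow> nat \<Rightarrow> bool" where
  "has_real_dimension S d \<longleftrightarrow> S \<noteq> {} \<and> smooth_submanifold d S"

lemma has_real_dimension_le:
  fixes S :: "'a::euclidean_space set"
  assumes "has_real_dimension S d" "has_real_dimension S e"
  shows "d \<le> e"
proof -
  obtain p where p: "p \<in> S" using assms(1) by (auto simp: has_real_dimension_def)
  obtain U L W and f g :: "'a \<Rightarrow> 'a" where 1: "open U" "p \<in> U" "subspace L" "dim L = d" "open W"
    "homeomorphism (W \<inter> L) (S \<inter> U) f g"
    using assms(1) p unfolding has_real_dimension_def smooth_submanifold_def by meson
  obtain U' L' W' and f' g' :: "'a \<Rightarrow> 'a" where 2: "open U'" "p \<in> U'" "subspace L'" "dim L' = e"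
    "open W'" "homeomorphism (W' \<inter> L') (S \<inter> U') f' g'"
    using assms(2) p unfolding has_real_dimension_def smooth_submanifold_def by meson
  define T where "T = (W \<inter> L) \<inter> f -` U'"
  have f: "continuous_on (W \<inter> L) f" "f ` (W \<inter> L) = S \<inter> U" "\<And>x. x \<in> W \<inter> L \<Longrightarrow> g (f x) = x"
    "\<And>y. y \<in> S \<inter> U \<Longrightarrow> f (g y) = y" "g ` (S \<inter> U) = W \<inter> L"
    using 1(6) by (auto simp: homeomorphism_def)
  have g': "continuous_on (S \<inter> U') g'" "g' ` (S \<inter> U') = W' \<inter> L'"
    "\<And>y. y \<in> S \<inter> U' \<Longrightarrow> f' (g' y) = y"
    using 2(6) by (auto simp: homeomorphism_def)
  have "openin (top_of_set (W \<inter> L)) T"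
    unfolding T_def using f(1) 2(1) by (rule continuous_openin_preimage_gen)
  then have T: "openin (top_of_set L) T"
    using \<open>open W\<close> by (metis inf_commute openin_open_Int openin_trans)
  have img: "f ` T \<subseteq> S \<inter> U'" using f(2) by (auto simp: T_def)
  have "continuous_on T (g' \<circ> f)"
    by (intro continuous_on_compose continuous_on_subset[OF f(1)] continuous_on_subset[OF g'(1)] img)
       (auto simp: T_def)
  moreover have "(g' \<circ> f) \<in> T \<rightarrow> L'" using img g'(2) by fastforce
  moreover have "inj_on (g' \<circ> f) T"
  proof (rule inj_onI)
    fix x y assume xy: "x \<in> T" "y \<in> T" "(g' \<circ> f) x = (g' \<circ> f) y"
    have "f x \<in> S \<inter> U'" "f y \<in> S \<inter> U'" using xy(1,2) img by blast+
    then have "f' (g' (f x)) = f x" "f' (g' (f y)) = f y" by (auto intro: g'(3))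
    moreover have "f' (g' (f x)) = f' (g' (f y))"
      using xy(3) unfolding comp_apply by (rule arg_cong)
    ultimately have "f x = f y" by argo
    have "x \<in> W \<inter> L" "y \<in> W \<inter> L" using xy by (simp_all add: T_def)
    then have "g (f x) = x" "g (f y) = y" by (auto intro: f(3))
    moreover have "g (f x) = g (f y)" using \<open>f x = f y\<close> by (rule arg_cong)
    ultimately show "x = y" by argo
  qed
  moreover have "T \<noteq> {}"
  proof -
    have "p \<in> S \<inter> U" using p 1(2) by simp
    then have "f (g p) = p" by (rule f(4))
    moreover have "g p \<in> W \<inter> L" using \<open>p \<in> S \<inter> U\<close> f(5) by blast
    ultimately show ?thesis using 2(2) by (auto simp: T_def)
  qed
  ultimately show ?thesis
    using invariance_of_dimension_subspaces[OF T 1(3) 2(3)] 1(4) 2(4) by blast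
qed

lemma has_real_dimension_unique:
  "has_real_dimension S d \<Longrightarrow> has_real_dimension S e \<Longrightarrow> d = e"
  using has_real_dimension_le by (blast intro: antisym)

end

theory Submission
  imports Defs "HOL-Computational_Algebra.Fundamental_Theorem_Algebra"
begin

text \<open>By the spectral theorem, a unitary matrix with eigenvalues \<open>\<mu>\<^sub>1, \<dots>, \<mu>\<^sub>I\<close> is the same thing as a
  resolution of the identity into mutually orthogonal projections \<open>Q\<^sub>1, \<dots>, Q\<^sub>I\<close>, and the multiplicity
  of \<open>\<mu>\<^sub>i\<close> is the trace of \<open>Q\<^sub>i\<close>. Such a resolution amounts to a flag, formed by the ranges of the
  partial sums \<open>Q\<^sub>1 + \<dots> + Q\<^sub>j\<close>, and the flags close to a coordinate flag are the images of the latter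
  under the block lower unitriangular matrices. The entries of that matrix below the diagonal blocks,
  together with the arguments of the \<open>I\<close> eigenvalues, are therefore local coordinates; there are
  \<open>(n\<^sup>2 - \<Sum> k\<^sub>i\<^sup>2) + I\<close> of them. The parametrisation is smooth because orthogonal projections
  onto column spaces are given by a formula with matrix inverses. The inverse map is
  continuous because eigenvalues and spectral projections depend continuously on a normal matrix as long as
  the eigenvalues do not split.\<close>

section \<open>Calculus of smooth maps\<close>

text \<open>Two demands of a chart shape the argument. Its inverse must be defined and continuous on
  all nearby matrices of the set, so eigenvalues and projections need labels that no choice can
  disturb: each eigenvalue takes the label of the base eigenvalue that it is near. And since the
  inverse is only shown to be continuous, injectivity of the differential does not follow from the
  chain rule; it comes from differentiating \<open>A Q = \<mu> Q\<close>, \<open>Q Q = Q\<close> and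
  \<open>adj Q = Q\<close> along a line.

  Only diagonal base points need work, because there the flag is a coordinate flag. Conjugation by a
  unitary matrix is linear and preserves the set, so it carries the chart to any other point.

  The unitriangular matrix is recovered from a flag by oblique projections: the projection onto the
  range of \<open>R\<close> along the kernel of the coordinate projection \<open>P\<close> has the
  range of \<open>R\<close>, yet agrees with \<open>P\<close> after applying \<open>P\<close>. That
  is precisely how a unitriangular matrix is normalised.

  For the count, each position below the diagonal blocks carries a complex entry, hence two real
  coordinates, one for itself and one for its mirror image above the blocks.\<close>

lemma frechet_derivative_cong:
  assumes "open W" "x \<in> W" "\<And>y. y \<in> W \<Longrightarrow> f y = g y"
  shows "frechet_derivative f (at x) = frechet_derivative g (at x)"
    and "f differentiable (at x) \<longleftrightarrow> g differentiable (at x)"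
proof -
  have "(f has_derivative D) (at x) \<longleftrightarrow> (g has_derivative D) (at x)" for D
    using has_derivative_transform_within_open[of f D x UNIV W g]
      has_derivative_transform_within_open[of g D x UNIV W f] assms by auto
  then show "frechet_derivative f (at x) = frechet_derivative g (at x)"
    and "f differentiable (at x) \<longleftrightarrow> g differentiable (at x)"
    by (simp_all add: frechet_derivative_def differentiable_def)
qed

lemma C_k_on_cong:
  assumes "open W" "\<And>y. y \<in> W \<Longrightarrow> f y = g y" "C_k_on k W f"
  shows "C_k_on k W g"
  using assms(2,3)
proof (induction k arbitrary: f g)
  case 0
  then show ?case by (auto intro: continuous_on_eq)
next
  case (Suc k)
  have eq: "frechet_derivative f (at x) v = frechet_derivative g (at x) v"
    "f differentiable (at x) \<longleftrightarrow> g differentiable (at x)" if "x \<in> W" for x v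
    using frechet_derivative_cong[OF assms(1) that, of f g] Suc.prems(1) by simp_all
  have "C_k_on k W (\<lambda>x. frechet_derivative f (at x) v)" for v using Suc.prems(2) by simp
  then have "C_k_on k W (\<lambda>x. frechet_derivative g (at x) v)" for v
    by (rule Suc.IH[rotated]) (rule eq(1))
  moreover have "\<forall>x\<in>W. g differentiable (at x)" using Suc.prems(2) eq(2) by simp
  ultimately show ?case by simp
qed

text \<open>Bridges the choice operator inside \<open>frechet_derivative\<close> and an explicit
  derivative \<open>D\<close>; the smoothness inductions below run through it. Openness of
  \<open>W\<close> lets agreement on \<open>W\<close> pass to all higher derivatives.\<close>

lemma C_k_on_SucI:
  assumes "open W" "\<And>x. x \<in> W \<Longrightarrow> (f has_derivative D x) (at x)" "\<And>v. C_k_on k W (\<lambda>x. D x v)"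
  shows "C_k_on (Suc k) W f"
proof -
  have "frechet_derivative f (at x) = D x" if "x \<in> W" for x
    using frechet_derivative_at[OF assms(2)[OF that]] by simp
  then have "C_k_on k W (\<lambda>x. frechet_derivative f (at x) v)" for v
    by (intro C_k_on_cong[OF assms(1) _ assms(3)[of v]]) simp
  moreover have "\<forall>x\<in>W. f differentiable (at x)"
    using assms(2) differentiable_def by blast
  ultimately show ?thesis by simp
qed

lemma C_k_on_SucD:
  assumes "C_k_on (Suc k) W f" "open W"
  shows "x \<in> W \<Longrightarrow> (f has_derivative frechet_derivative f (at x)) (at x)"
    and "C_k_on k W (\<lambda>x. frechet_derivative f (at x) v)"
  using assms by (auto simp: frechet_derivative_works[symmetric])

lemma C_k_on_Suc_imp: 
  assumes "open W" shows "C_k_on (Suc k) W f \<Longrightarrow> C_k_on k W f"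
proof (induction k arbitrary: f)
  case 0
  then show ?case by (auto intro!: continuous_at_imp_continuous_on differentiable_imp_continuous_within)
next
  case (Suc k)
  then show ?case by (metis C_k_on.simps(2))
qed

lemma C_k_on_const: "open W \<Longrightarrow> C_k_on k W (\<lambda>_. c)"
proof (induction k arbitrary: c)
  case (Suc k)
  then show ?case by (intro C_k_on_SucI[where D="\<lambda>_ _. 0"]) auto
qed simp

lemma C_k_on_bounded_linear:
  assumes "bounded_linear h" "open W" shows "C_k_on k W f \<Longrightarrow> C_k_on k W (\<lambda>x. h (f x))"
proof (induction k arbitrary: f)
  case 0
  then show ?case using bounded_linear.continuous_on[OF assms(1)] by auto
next
  case (Suc k)
  note D = C_k_on_SucD[OF Suc.prems assms(2)]
  show ?case
    by (rule C_k_on_SucI[OF assms(2) bounded_linear.has_derivative[OF assms(1) D(1)] Suc.IH[OF D(2)]])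
qed

lemma C_k_on_add:
  assumes "open W" shows "C_k_on k W f \<Longrightarrow> C_k_on k W g \<Longrightarrow> C_k_on k W (\<lambda>x. f x + g x)"
proof (induction k arbitrary: f g)
  case 0
  then show ?case by (auto intro: continuous_intros)
next
  case (Suc k)
  note D = C_k_on_SucD[OF Suc.prems(1) assms] and D' = C_k_on_SucD[OF Suc.prems(2) assms]
  show ?case
    by (rule C_k_on_SucI[OF assms has_derivative_add[OF D(1) D'(1)] Suc.IH[OF D(2) D'(2)]])
qed

lemma C_k_on_bounded_bilinear:
  assumes "bounded_bilinear h" "open W"
  shows "C_k_on k W f \<Longrightarrow> C_k_on k W g \<Longrightarrow> C_k_on k W (\<lambda>x. h (f x) (g x))"
proof (induction k arbitrary: f g)
  case 0
  then show ?case using bounded_bilinear.continuous_on[OF assms(1)] by auto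
next
  case (Suc k)
  note D = C_k_on_SucD[OF Suc.prems(1) assms(2)] and D' = C_k_on_SucD[OF Suc.prems(2) assms(2)]
  \<comment> \<open>The product rule leaves one factor undifferentiated in each summand, so
    \<open>f\<close> and \<open>g\<close> themselves are needed at order \<open>k\<close>, one below
    what is assumed.\<close>
  show ?case
    by (rule C_k_on_SucI[OF assms(2) bounded_bilinear.FDERIV[OF assms(1) D(1) D'(1)]
          C_k_on_add[OF assms(2) Suc.IH[OF C_k_on_Suc_imp[OF assms(2) Suc.prems(1)] D'(2)]
            Suc.IH[OF D(2) C_k_on_Suc_imp[OF assms(2) Suc.prems(2)]]]])
qed

lemma C_k_on_id: "open W \<Longrightarrow> C_k_on k W (\<lambda>x. x)"
proof (cases k)
  case (Suc k')
  assume W: "open W"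
  show ?thesis unfolding Suc
    by (rule C_k_on_SucI[OF W, where D="\<lambda>_ v. v"]) (auto intro: C_k_on_const[OF W])
qed auto

lemma C_infinity_on_const: "open W \<Longrightarrow> C_infinity_on W (\<lambda>_. c)"
  and C_infinity_on_id: "open W \<Longrightarrow> C_infinity_on W (\<lambda>x. x)"
  and C_infinity_on_add:
    "open W \<Longrightarrow> C_infinity_on W f \<Longrightarrow> C_infinity_on W g \<Longrightarrow> C_infinity_on W (\<lambda>x. f x + g x)"
  and C_infinity_on_bounded_linear:
    "bounded_linear h \<Longrightarrow> open W \<Longrightarrow> C_infinity_on W f \<Longrightarrow> C_infinity_on W (\<lambda>x. h (f x))"
  and C_infinity_on_bounded_bilinear:
    "bounded_bilinear b \<Longrightarrow> open W \<Longrightarrow> C_infinity_on W f \<Longrightarrow> C_infinity_on W f' \<Longrightarrow>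
      C_infinity_on W (\<lambda>x. b (f x) (f' x))"
  by (simp_all add: C_infinity_on_def C_k_on_const C_k_on_id C_k_on_add C_k_on_bounded_linear
      C_k_on_bounded_bilinear)

lemma C_infinity_on_sum:
  assumes "open W" shows "(\<And>i. i \<in> S \<Longrightarrow> C_infinity_on W (f i)) \<Longrightarrow> C_infinity_on W (\<lambda>x. \<Sum>i\<in>S. f i x)"
  by (induction S rule: infinite_finite_induct)
    (auto intro: C_infinity_on_const C_infinity_on_add assms)

lemma C_infinity_on_diff:
  assumes "open W" "C_infinity_on W f" "C_infinity_on W g"
  shows "C_infinity_on W (\<lambda>x. f x - g x)"
proof -
  have "C_infinity_on W (\<lambda>x. - g x)"
    by (rule C_infinity_on_bounded_linear[OF bounded_linear_minus[OF bounded_linear_ident] assms(1,3)])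
  from C_infinity_on_add[OF assms(1,2) this] show ?thesis by simp
qed

lemma C_infinity_on_differentiable:
  assumes "C_infinity_on W f" "x \<in> W" shows "f differentiable (at x)"
  using assms C_k_on.simps(2)[of 0 W f] unfolding C_infinity_on_def by blast

lemma C_infinity_on_imp_continuous_on: "C_infinity_on W f \<Longrightarrow> continuous_on W f"
  unfolding C_infinity_on_def by (metis C_k_on.simps(1))

lemma C_infinity_on_subset:
  assumes "C_infinity_on W f" "W' \<subseteq> W" shows "C_infinity_on W' f"
proof -
  have "C_k_on k W f \<Longrightarrow> C_k_on k W' f" for k
    using assms(2) by (induction k arbitrary: f) (auto intro: continuous_on_subset)
  then show ?thesis using assms(1) by (simp add: C_infinity_on_def)
qed

lemma C_infinity_on_exp_linear:
  fixes h :: "'a::euclidean_space \<Rightarrow> complex"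
  assumes "bounded_linear h" "open W"
  shows "C_infinity_on W (\<lambda>x. exp (h x))"
proof -
  have D: "((\<lambda>x. exp (h x)) has_derivative (\<lambda>v. h v * exp (h x))) (at x)" for x
    using has_derivative_compose[OF bounded_linear_imp_has_derivative[OF assms(1)]
        DERIV_exp[of "h x", unfolded has_field_derivative_def]] by (simp add: mult.commute)
  have "C_k_on k W (\<lambda>x. exp (h x))" for k
  proof (induction k)
    case 0
    show ?case
      by (auto intro!: continuous_intros bounded_linear.continuous_on[OF assms(1)])
  next
    case (Suc k)
    show ?case
      by (rule C_k_on_SucI[OF assms(2) D C_k_on_bounded_linear[OF bounded_linear_mult_right assms(2) Suc]])
  qed
  then show ?thesis by (simp add: C_infinity_on_def)
qed

text \<open>Stated for an abstract product, so that it applies to matrix inversion.\<close>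

lemma tendsto_bilinear_inverse:
  fixes F J :: "'a \<Rightarrow> 'b::real_normed_vector"
  assumes b: "bounded_bilinear b" and F: "(F \<longlongrightarrow> F x) net"
    and J: "\<forall>\<^sub>F y in net. J y - J x = - b (b (J y) (F y - F x)) (J x)"
  shows "(J \<longlongrightarrow> J x) net"
proof -
  interpret b: bounded_bilinear b by fact
  obtain K where K: "K > 0" "\<And>u v. norm (b u v) \<le> norm u * norm v * K"
    using b.pos_bounded by blast
  \<comment> \<open>This makes \<open>e * (K * K * (norm (J x) + 1))\<close> equal to 1/2, so that
    \<open>norm (J y)\<close> is at most \<open>norm (J x)\<close> plus half of itself. The summand
    1 keeps the denominator positive when \<open>J x = 0\<close>.\<close>
  define e where "e = 1 / (2 * (K * K * (norm (J x) + 1)))"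
  have e: "e > 0" unfolding e_def using K by (simp add: add_nonneg_pos)
  have step: "norm (J y - J x) \<le> (norm (J y) * norm (F y - F x) * K) * norm (J x) * K"
    if "J y - J x = - b (b (J y) (F y - F x)) (J x)" for y
  proof -
    have "norm (J y - J x) \<le> norm (b (J y) (F y - F x)) * norm (J x) * K"
      using K(2) that by simp
    also have "\<dots> \<le> (norm (J y) * norm (F y - F x) * K) * norm (J x) * K"
      using K(1) by (intro mult_right_mono K(2)) auto
    finally show ?thesis .
  qed
  have bound: "norm (J y) \<le> 2 * norm (J x)"
    if "norm (F y - F x) < e" and Jy: "J y - J x = - b (b (J y) (F y - F x)) (J x)" for y
  proof -
    have "norm (J y) \<le> norm (J x) + norm (J y - J x)" by (metis norm_triangle_sub)
    also have "norm (J y - J x) \<le> norm (J y) * (norm (F y - F x) * (K * K * norm (J x)))"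
      using step[OF Jy] by (simp add: mult_ac)
    also have "\<dots> \<le> norm (J y) * (e * (K * K * (norm (J x) + 1)))"
      using that K e by (intro mult_left_mono mult_mono) auto
    also have "e * (K * K * (norm (J x) + 1)) = 1 / 2"
      using K norm_ge_zero[of "J x"] unfolding e_def by (simp add: field_simps add_nonneg_eq_0_iff)
    finally show ?thesis by simp
  qed
  have ev: "\<forall>\<^sub>F y in net. norm (F y - F x) < e"
    using F e by (simp add: tendsto_iff dist_norm)
  have "((\<lambda>y. F y - F x) \<longlongrightarrow> 0) net" using F by (simp add: LIM_zero)
  then have z: "((\<lambda>y. norm (F y - F x) * (2 * norm (J x) * norm (J x) * K * K)) \<longlongrightarrow> 0) net"
    by (intro tendsto_mult_left_zero tendsto_norm_zero)
  have "((\<lambda>y. J y - J x) \<longlongrightarrow> 0) net"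
  proof (rule Lim_null_comparison[OF _ z])
    show "\<forall>\<^sub>F y in net. norm (J y - J x) \<le> norm (F y - F x) * (2 * norm (J x) * norm (J x) * K * K)"
      using ev J
    proof eventually_elim
      case (elim y)
      have "(norm (J y) * norm (F y - F x) * K) * norm (J x) * K
          \<le> ((2 * norm (J x)) * norm (F y - F x) * K) * norm (J x) * K"
        using K bound[OF elim] by (intro mult_right_mono) auto
      with step[OF elim(2)] show ?case by (simp add: mult_ac)
    qed
  qed
  then show ?thesis by (simp add: LIM_zero_iff)
qed

text \<open>The resolvent identity splits the remainder of \<open>J\<close> in two: the remainder of
  \<open>F\<close> multiplied by \<open>J y\<close>, and \<open>J y - J x\<close> multiplied by a
  quotient of \<open>F'\<close> that stays bounded. Both tend to 0 because \<open>J\<close> is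
  continuous at \<open>x\<close>.\<close>

lemma has_derivative_bilinear_inverse:
  fixes F J :: "'a::real_normed_vector \<Rightarrow> 'b::real_normed_vector"
  assumes b: "bounded_bilinear b" and F: "(F has_derivative F') (at x)"
    and J: "\<And>y. J y - J x = - b (b (J y) (F y - F x)) (J x)"
  shows "(J has_derivative (\<lambda>h. - b (b (J x) (F' h)) (J x))) (at x)"
proof -
  interpret b: bounded_bilinear b by fact
  obtain K where K: "K > 0" "\<And>u v. norm (b u v) \<le> norm u * norm v * K"
    using b.pos_bounded by blast
  have "\<forall>\<^sub>F y in at x. J y - J x = - b (b (J y) (F y - F x)) (J x)"
    by (intro always_eventually allI J)
  moreover have "(F \<longlongrightarrow> F x) (at x)" using has_derivative_continuous[OF F] by (simp add: continuous_at)
  ultimately have cJ: "(J \<longlongrightarrow> J x) (at x)" by (rule tendsto_bilinear_inverse[OF b, rotated])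
  have F1: "bounded_linear F'" and F2: "((\<lambda>y. (F y - F x - F' (y - x)) /\<^sub>R norm (y - x)) \<longlongrightarrow> 0) (at x)"
    using F by (auto simp: has_derivative_at2 diff_diff_eq inverse_eq_divide)
  obtain B where B: "B > 0" "\<And>v. norm (F' v) \<le> norm v * B"
    using bounded_linear.pos_bounded[OF F1] by blast
  have r1: "((\<lambda>y. b (b (J y) ((F y - F x - F' (y - x)) /\<^sub>R norm (y - x))) (J x)) \<longlongrightarrow> b (b (J x) 0) (J x)) (at x)"
    by (intro b.tendsto cJ F2 tendsto_const)
  have r2: "((\<lambda>y. b (b (J y - J x) (F' (y - x) /\<^sub>R norm (y - x))) (J x)) \<longlongrightarrow> 0) (at x)"
  proof (rule Lim_null_comparison)
    have "((\<lambda>y. norm (J y - J x) * (B * K * norm (J x) * K)) \<longlongrightarrow> 0) (at x)"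
      using cJ by (intro tendsto_mult_left_zero tendsto_norm_zero) (simp add: LIM_zero)
    then show "((\<lambda>y. norm (J y - J x) * B * K * norm (J x) * K) \<longlongrightarrow> 0) (at x)"
      by (simp add: mult.assoc)
    show "\<forall>\<^sub>F y in at x. norm (b (b (J y - J x) (F' (y - x) /\<^sub>R norm (y - x))) (J x))
        \<le> norm (J y - J x) * B * K * norm (J x) * K"
    proof (rule always_eventually, rule allI)
      fix y
      \<comment> \<open>At \<open>y = x\<close> the quotient is 0, as division by zero gives 0, so
        the bound holds for every \<open>y\<close>.\<close>
      have n: "norm (F' (y - x) /\<^sub>R norm (y - x)) \<le> B"
        using B(2)[of "y - x"] B(1) by (cases "y = x") (auto simp: field_simps linear_0[OF bounded_linear.linear[OF F1]])
      have "norm (b (b (J y - J x) (F' (y - x) /\<^sub>R norm (y - x))) (J x))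
          \<le> norm (b (J y - J x) (F' (y - x) /\<^sub>R norm (y - x))) * norm (J x) * K" by (rule K(2))
      also have "\<dots> \<le> (norm (J y - J x) * norm (F' (y - x) /\<^sub>R norm (y - x)) * K) * norm (J x) * K"
        using K(1) by (intro mult_right_mono K(2)) auto
      also have "\<dots> \<le> (norm (J y - J x) * B * K) * norm (J x) * K"
        using K(1) by (intro mult_right_mono mult_left_mono n) auto
      finally show "norm (b (b (J y - J x) (F' (y - x) /\<^sub>R norm (y - x))) (J x))
        \<le> norm (J y - J x) * B * K * norm (J x) * K" by simp
    qed
  qed
  have "((\<lambda>y. (J y - J x - (- b (b (J x) (F' (y - x))) (J x))) /\<^sub>R norm (y - x)) \<longlongrightarrow> 0) (at x)"
  proof -
    have "(J y - J x - (- b (b (J x) (F' (y - x))) (J x))) /\<^sub>R norm (y - x)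
      = - (b (b (J y) ((F y - F x - F' (y - x)) /\<^sub>R norm (y - x))) (J x)
        + b (b (J y - J x) (F' (y - x) /\<^sub>R norm (y - x))) (J x))" (is "?l = ?r") for y
    proof -
      have eq: "J y - J x - (- b (b (J x) (F' (y - x))) (J x))
        = b (b (J x) (F' (y - x))) (J x) - b (b (J y) (F y - F x)) (J x)" using J[of y] by simp
      show ?thesis
        unfolding eq by (simp add: b.diff_left b.diff_right b.scaleR_left b.scaleR_right
            scaleR_right_diff_distrib)
    qed
    then show ?thesis
      using tendsto_minus[OF tendsto_add[OF r1 r2]] by (simp add: b.zero_left b.zero_right)
  qed
  moreover have "bounded_linear (\<lambda>h. - b (b (J x) (F' h)) (J x))"
    by (intro bounded_linear_minus bounded_linear_compose[OF b.bounded_linear_left]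
        bounded_linear_compose[OF b.bounded_linear_right] F1)
  ultimately show ?thesis unfolding has_derivative_at2 by (simp add: inverse_eq_divide algebra_simps)
qed

text \<open>A bootstrap: the derivative of \<open>J\<close> is a product of \<open>J\<close> and the
  derivative of \<open>F\<close>, so \<open>J\<close> of class k makes the derivative of class k and
  \<open>J\<close> of class k + 1.\<close>

lemma C_infinity_on_bilinear_inverse:
  fixes F J :: "'a::euclidean_space \<Rightarrow> 'b::euclidean_space"
  assumes b: "bounded_bilinear b" and F: "C_infinity_on UNIV F"
    and J: "\<And>x y. J y - J x = - b (b (J y) (F y - F x)) (J x)"
  shows "C_infinity_on UNIV J"
proof -
  have D: "(J has_derivative (\<lambda>h. - b (b (J x) (frechet_derivative F (at x) h)) (J x))) (at x)" for x
    using C_infinity_on_differentiable[OF F] J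
    by (intro has_derivative_bilinear_inverse[OF b]) (auto simp: frechet_derivative_works[symmetric])
  have "C_k_on k UNIV J" for k
  proof (induction k)
    case 0
    show ?case using D by (auto intro!: continuous_at_imp_continuous_on has_derivative_continuous)
  next
    case (Suc k)
    have "C_k_on (Suc k) UNIV F" using F by (simp only: C_infinity_on_def)
    then have "C_k_on k UNIV (\<lambda>x. frechet_derivative F (at x) v)" for v by simp
    then have "C_k_on k UNIV (\<lambda>x. b (b (J x) (frechet_derivative F (at x) v)) (J x))" for v
      by (intro C_k_on_bounded_bilinear[OF b] Suc) auto
    then show ?case
      by (intro C_k_on_SucI[OF _ D] C_k_on_bounded_linear[OF bounded_linear_minus[OF bounded_linear_ident]]) auto
  qed
  then show ?thesis by (simp add: C_infinity_on_def)
qed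

section \<open>Complex matrices\<close>

lemma bounded_bilinear_matrix_mult:
  "bounded_bilinear ((**) :: complex^'n^'n \<Rightarrow> complex^'n^'n \<Rightarrow> complex^'n^'n)"
proof -
  have "bilinear ((**) :: complex^'n^'n \<Rightarrow> complex^'n^'n \<Rightarrow> complex^'n^'n)"
    unfolding bilinear_def
    by (intro conjI allI linearI)
      (simp_all add: vec_eq_iff matrix_matrix_mult_def sum.distrib algebra_simps scaleR_sum_right)
  then show ?thesis by (simp add: bilinear_conv_bounded_bilinear)
qed

interpretation mm: bounded_bilinear "(**) :: complex^'n^'n \<Rightarrow> complex^'n^'n \<Rightarrow> complex^'n^'n"
  by (rule bounded_bilinear_matrix_mult)

lemmas mm_assoc = matrix_mul_assoc[symmetric]
lemmas mm_distribs = mm.add_left mm.add_right mm.diff_left mm.diff_right mm.minus_left mm.minus_right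

text \<open>Complex multiples of a matrix are written \<open>mat c ** A\<close> throughout; the
  rules from here on move such scalar factors through products.\<close>

lemma mat_mult_commute: "mat c ** A = A ** mat (c::'a::comm_semiring_1)"
  by (simp add: vec_eq_iff matrix_matrix_mult_def mat_def if_distrib[of "\<lambda>x. x * _"] 
      if_distrib[of "\<lambda>x. _ * x"] mult.commute cong: if_cong)

lemma mat_mult_component: "(mat c ** A) $ i $ j = (c::'a::comm_semiring_1) * A $ i $ j"
  by (simp add: matrix_matrix_mult_def mat_def if_distrib[of "\<lambda>x. x * _"] cong: if_cong)

lemma mat_mult_mat: "mat c ** mat d = mat (c * d :: 'a::comm_semiring_1)"
  by (simp add: vec_eq_iff mat_mult_component) (simp add: mat_def)

lemma mat_mult_left_commute: "A ** (mat c ** B) = mat (c::'a::comm_semiring_1) ** (A ** B)"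
  by (metis mat_mult_commute matrix_mul_assoc)

lemma mat_diff: "mat (c - d) = mat c - mat (d :: complex)"
  by (simp add: vec_eq_iff mat_def)

lemma bounded_linear_mat: "bounded_linear (mat :: complex \<Rightarrow> complex^'n^'n)"
  by (intro linear_conv_bounded_linear[THEN iffD1] linearI) (simp_all add: vec_eq_iff mat_def)

lemma mat_eq_0_iff: "mat c ** A = 0 \<longleftrightarrow> c = 0 \<or> A = (0::complex^'n^'n)"
  by (auto simp: vec_eq_iff mat_mult_component)

abbreviation adj :: "complex^'n^'m \<Rightarrow> complex^'m^'n" where "adj \<equiv> conj_transpose"

lemma adj_component [simp]: "adj A $ i $ j = cnj (A $ j $ i)"
  by (simp add: conj_transpose_def)

lemma adj_simps [simp]: "adj (adj A) = A" "adj (A + B) = adj A + adj B" "adj (A - B) = adj A - adj B"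
  "adj 0 = 0" "adj (mat c) = mat (cnj c)"
  by (simp_all add: vec_eq_iff mat_def)

lemma adj_mult: "adj (A ** B) = adj B ** adj A"
  by (simp add: vec_eq_iff matrix_matrix_mult_def mult.commute)

lemma adj_sum: "adj (\<Sum>i\<in>S. f i) = (\<Sum>i\<in>S. adj (f i))"
  by (induction S rule: infinite_finite_induct) auto

lemma bounded_linear_adj: "bounded_linear (adj :: complex^'n^'n \<Rightarrow> complex^'n^'n)"
  by (intro linear_conv_bounded_linear[THEN iffD1] linearI) (simp_all add: vec_eq_iff)

lemma trace_mult_commute: "trace (A ** B) = trace (B ** (A::complex^'n^'n))"
  unfolding trace_def matrix_matrix_mult_def by (simp add: mult.commute) (rule sum.swap)

lemma inner_matrix: "A \<bullet> B = Re (trace (adj A ** (B::complex^'n^'n)))"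
proof -
  have "A \<bullet> B = (\<Sum>i\<in>UNIV. \<Sum>j\<in>UNIV. Re (cnj (A $ i $ j) * B $ i $ j))"
    by (simp add: inner_vec_def inner_complex_def)
  also have "\<dots> = (\<Sum>j\<in>UNIV. \<Sum>i\<in>UNIV. Re (cnj (A $ i $ j) * B $ i $ j))"
    by (rule sum.swap)
  finally show ?thesis by (simp add: trace_def matrix_matrix_mult_def)
qed

lemma inner_mult_left: "(A ** B) \<bullet> C = B \<bullet> (adj A ** C)"
  and inner_mult_right: "(A ** B) \<bullet> C = A \<bullet> (C ** adj B)" for A B C :: "complex^'n^'n"
proof -
  show "(A ** B) \<bullet> C = B \<bullet> (adj A ** C)" by (simp add: inner_matrix adj_mult mm_assoc)
  have "trace (adj B ** (adj A ** C)) = trace ((adj A ** C) ** adj B)" by (rule trace_mult_commute)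
  then show "(A ** B) \<bullet> C = A \<bullet> (C ** adj B)" by (simp add: inner_matrix adj_mult mm_assoc)
qed

text \<open>Since \<open>Q\<close> is self-adjoint and idempotent, the squared norm of
  \<open>Q ** B\<close> is the inner product of \<open>B\<close> with \<open>Q ** B\<close>, and
  Cauchy-Schwarz applies. This bounds sandwiched differences \<open>E ** (A - B) ** Q\<close>
  without constants.\<close>

lemma norm_projection_mult_le:
  fixes Q :: "complex^'n^'n"
  assumes "adj Q = Q" "Q ** Q = Q"
  shows "norm (Q ** B) \<le> norm B" "norm (B ** Q) \<le> norm B"
proof -
  have *: "norm X \<le> norm Y" if "X \<bullet> X = Y \<bullet> X" for X Y :: "complex^'n^'n"
  proof (cases "X = 0")
    case False
    have "norm X * norm X \<le> norm Y * norm X"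
      using that norm_cauchy_schwarz[of Y X] by (simp add: dot_square_norm power2_eq_square)
    with False show ?thesis by simp
  qed simp
  have "(Q ** B) \<bullet> (Q ** B) = B \<bullet> (Q ** B)"
    by (simp add: inner_mult_left assms matrix_mul_assoc)
  then show "norm (Q ** B) \<le> norm B" by (rule *)
  have "(B ** Q) \<bullet> (B ** Q) = B \<bullet> (B ** Q)"
    by (simp add: inner_mult_right assms mm_assoc)
  then show "norm (B ** Q) \<le> norm B" by (rule *)
qed

text \<open>Left multiplication by \<open>A\<close> is a linear endomorphism of the
  finite-dimensional space of matrices; if injective, it is onto, and a preimage of
  \<open>mat 1\<close> is an inverse.\<close>

lemma invertible_if_left_cancel:
  fixes A :: "complex^'n^'n"
  assumes "\<And>Y :: complex^'n^'n. A ** Y = 0 \<Longrightarrow> Y = 0"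
  shows "invertible A"
proof -
  have lin: "linear ((**) A :: complex^'n^'n \<Rightarrow> complex^'n^'n)" using mm.bounded_linear_right by (rule bounded_linear.linear)
  then have "inj ((**) A :: complex^'n^'n \<Rightarrow> complex^'n^'n)" using assms by (simp add: linear_injective_0)
  then have "surj ((**) A :: complex^'n^'n \<Rightarrow> complex^'n^'n)" using lin linear_injective_imp_surjective by blast
  then show ?thesis by (metis invertible_right_inverse surjD)
qed

lemma matrix_inv_mult:
  fixes A :: "complex^'n^'n"
  assumes "invertible A" shows "A ** matrix_inv A = mat 1" "matrix_inv A ** A = mat 1"
proof -
  have "\<exists>A'. A ** A' = mat 1 \<and> A' ** A = mat 1" using assms by (simp add: invertible_def)
  from someI_ex[OF this] show "A ** matrix_inv A = mat 1" "matrix_inv A ** A = mat 1"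
    by (simp_all add: matrix_inv_def)
qed

text \<open>The resolvent identity, in the form that the abstract inversion lemmas take as
  hypothesis.\<close>

lemma matrix_inv_diff:
  fixes A B :: "complex^'n^'n"
  assumes "invertible A" "invertible B"
  shows "matrix_inv B - matrix_inv A = - (matrix_inv B ** (B - A) ** matrix_inv A)"
  using assms by (simp add: mm_distribs matrix_inv_mult) (simp add: mm_assoc matrix_inv_mult)

lemma commute_matrix_inv:
  fixes A Z :: "complex^'n^'n"
  assumes "invertible Z" "A ** Z = Z ** A"
  shows "A ** matrix_inv Z = matrix_inv Z ** A"
proof -
  have "matrix_inv Z ** (A ** Z) ** matrix_inv Z = matrix_inv Z ** (Z ** A) ** matrix_inv Z"
    by (simp add: assms(2))
  moreover have "matrix_inv Z ** (A ** Z) ** matrix_inv Z = matrix_inv Z ** A"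
    by (simp add: mm_assoc matrix_inv_mult assms(1))
  moreover have "matrix_inv Z ** (Z ** A) ** matrix_inv Z = A ** matrix_inv Z"
    by (simp add: matrix_mul_assoc matrix_inv_mult assms(1))
  ultimately show ?thesis by metis
qed

lemma adj_matrix_inv:
  fixes A :: "complex^'n^'n"
  assumes "invertible A" "adj A = A" shows "adj (matrix_inv A) = matrix_inv A"
proof -
  have "adj (matrix_inv A) ** A = mat 1"
    using arg_cong[OF matrix_inv_mult(1)[OF assms(1)], of adj] assms(2) by (simp add: adj_mult)
  then have "adj (matrix_inv A) ** A ** matrix_inv A = matrix_inv A" by simp
  then show ?thesis by (simp add: mm_assoc matrix_inv_mult assms(1))
qed

lemma unitary_matrix_mult:
  fixes V :: "complex^'n^'n"
  assumes "unitary_matrix V" shows "V ** adj V = mat 1" "adj V ** V = mat 1"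
  using assms unfolding unitary_matrix_def by (auto simp: matrix_left_right_inverse[of V])

lemma unitary_matrix_cancel:
  fixes V :: "complex^'n^'n"
  assumes "unitary_matrix V" shows "V ** (adj V ** X) = X" "adj V ** (V ** X) = X"
  by (simp_all add: matrix_mul_assoc unitary_matrix_mult[OF assms])

lemma unitary_matrix_adj:
  fixes V :: "complex^'n^'n"
  assumes "unitary_matrix V" shows "unitary_matrix (adj V)"
  using unitary_matrix_mult[OF assms] by (simp add: unitary_matrix_def)

lemma unitary_matrix_times:
  fixes V :: "complex^'n^'n"
  assumes "unitary_matrix V" "unitary_matrix W" shows "unitary_matrix (V ** W)"
  unfolding unitary_matrix_def
  by (simp add: adj_mult mm_assoc unitary_matrix_cancel[OF assms(2)] unitary_matrix_mult[OF assms(1)])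

section \<open>Diagonal matrices and coordinate projections\<close>

definition diag :: "('n \<Rightarrow> complex) \<Rightarrow> complex^'n^'n" where
  "diag d = (\<chi> i j. if i = j then d i else 0)"

lemma diag_component: "diag d $ i $ j = (if i = j then d i else 0)"
  by (simp add: diag_def)

lemma diag_mult_component: "(diag d ** A) $ i $ j = d i * A $ i $ j"
  by (simp add: diag_def matrix_matrix_mult_def if_distrib[of "\<lambda>x. x * _"] cong: if_cong)

lemma mult_diag_component: "(A ** diag d) $ i $ j = A $ i $ j * d j"
  by (simp add: diag_def matrix_matrix_mult_def if_distrib[of "\<lambda>x. _ * x"] cong: if_cong)

lemma diag_mult: "diag d ** diag e = diag (\<lambda>a. d a * e a)"
  by (simp add: vec_eq_iff diag_mult_component) (simp add: diag_def)

lemma adj_diag: "adj (diag d) = diag (\<lambda>a. cnj (d a))"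
  by (auto simp: vec_eq_iff diag_def)

lemma diag_sum: "(\<Sum>i\<in>S. diag (d i)) = diag (\<lambda>a. \<Sum>i\<in>S. d i a)"
  by (auto simp: vec_eq_iff diag_def)

lemma diag_const: "diag (\<lambda>_. c) = mat c"
  by (simp add: diag_def mat_def)

lemma trace_diag: "trace (diag d) = (\<Sum>a\<in>UNIV. d a)"
  by (simp add: trace_def diag_def)

definition proj :: "'n set \<Rightarrow> complex^'n^'n" where
  "proj S = diag (indicator S)"

lemma proj_mult: "proj S ** proj T = proj (S \<inter> T)"
  unfolding proj_def diag_mult by (rule arg_cong[of _ _ diag]) (auto simp: indicator_def)

lemma adj_proj [simp]: "adj (proj S) = proj S"
  unfolding proj_def adj_diag by (rule arg_cong[of _ _ diag]) (auto simp: indicator_def)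

lemma trace_proj: "trace (proj S :: complex^'n^'n) = of_nat (card (S::'n::finite set))"
  by (simp add: proj_def trace_diag indicator_def)

lemma proj_mult_component: "(proj S ** A) $ i $ j = (if i \<in> S then A $ i $ j else 0)"
  by (simp add: proj_def diag_mult_component)

lemma mult_proj_component: "(A ** proj S) $ i $ j = (if j \<in> S then A $ i $ j else 0)"
  by (simp add: proj_def mult_diag_component)

lemma proj_component: "proj S $ i $ j = (if i = j \<and> i \<in> S then 1 else 0)"
  by (simp add: proj_def diag_component)

section \<open>The spectral theorem for unitary matrices\<close>

lemma matrix_vector_mult_sum: "A *v (\<Sum>i\<in>S. f i) = (\<Sum>i\<in>S. A *v (f i :: complex^'n))"
  by (induction S rule: infinite_finite_induct) (auto simp: matrix_vector_right_distrib)

text \<open>If \<open>p\<close> has least degree among the nonzero polynomials with \<open>p(A) w = 0\<close> and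
  \<open>p = (x - z) q\<close>, then \<open>q(A) w\<close> is an eigenvector.\<close>

lemma eigenvector_in_invariant_set:
  fixes A :: "complex^'n^'n"
  assumes "w \<in> S" "w \<noteq> 0" "0 \<in> S" "\<And>x y. x \<in> S \<Longrightarrow> y \<in> S \<Longrightarrow> x + y \<in> S"
    "\<And>c x. x \<in> S \<Longrightarrow> c *s x \<in> S" "\<And>x. x \<in> S \<Longrightarrow> A *v x \<in> S"
  obtains u z where "u \<in> S" "u \<noteq> 0" "A *v u = z *s u"
proof -
  define K where "K m = (((*v) A) ^^ m) w" for m
  define app where "app p = (\<Sum>m\<le>degree p. coeff p m *s K m)" for p :: "complex poly"
  have app_eq: "app p = (\<Sum>m\<le>N. coeff p m *s K m)" if "degree p \<le> N" for p N
    unfolding app_def using that by (intro sum.mono_neutral_left) (auto simp: coeff_eq_0)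
  have KS: "K m \<in> S" for m unfolding K_def using assms by (induction m) auto
  have sumS: "(\<Sum>m\<in>T. g m) \<in> S" if "\<And>m. g m \<in> S" for g and T :: "nat set"
    using assms that by (induction T rule: infinite_finite_induct) auto
  have appS: "app p \<in> S" for p unfolding app_def by (intro sumS assms(5) KS)
  define N where "N = DIM(complex^'n)"
  have "\<exists>c::nat \<Rightarrow> real. (\<exists>m\<le>N. c m \<noteq> 0) \<and> (\<Sum>m\<le>N. c m *\<^sub>R K m) = 0"
  \<comment> \<open>\<open>dependent\<close> concerns the set of values, which is too small to be
    dependent by counting if two iterates coincide; that case has an evident relation of its
    own.\<close>
  proof (cases "inj_on K {..N}")
    case True
    then have "card (K ` {..N}) = Suc N" by (simp add: card_image)
    then have "dependent (K ` {..N})" unfolding N_def using independent_bound by fastforce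
    then obtain u where u: "\<exists>v\<in>K ` {..N}. u v \<noteq> 0" "(\<Sum>v\<in>K ` {..N}. u v *\<^sub>R v) = 0"
      by (auto simp: dependent_finite)
    then show ?thesis using True by (intro exI[of _ "\<lambda>m. u (K m)"]) (auto simp: sum.reindex)
  next
    case False
    then obtain i j where ij: "i \<le> N" "j \<le> N" "i \<noteq> j" "K i = K j" by (auto simp: inj_on_def)
    have "(\<Sum>m\<le>N. (if m = i then 1 else if m = j then -1 else 0) *\<^sub>R K m)
        = (\<Sum>m\<le>N. (if m = i then K m else 0) - (if m = j then K m else 0))"
      using ij by (intro sum.cong) auto
    also have "\<dots> = 0" using ij by (simp add: sum_subtractf)
    finally show ?thesis using ij by (intro exI[of _ "\<lambda>m. if m = i then 1 else if m = j then -1 else 0"]) auto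
  qed
  then obtain c :: "nat \<Rightarrow> real" where c: "\<exists>m\<le>N. c m \<noteq> 0" "(\<Sum>m\<le>N. c m *\<^sub>R K m) = 0" by blast
  define p0 where "p0 = (\<Sum>m\<le>N. monom (complex_of_real (c m)) m)"
  have p0: "coeff p0 m = (if m \<le> N then complex_of_real (c m) else 0)" for m
    by (simp add: p0_def coeff_sum)
  have "p0 \<noteq> 0" using c(1) p0 by (metis coeff_0 of_real_eq_0_iff)
  moreover have "degree p0 \<le> N" by (intro degree_le) (auto simp: p0)
  then have "app p0 = (\<Sum>m\<le>N. c m *\<^sub>R K m)"
    by (subst app_eq) (auto simp: p0 vec_eq_iff scaleR_conv_of_real[where 'a=complex])
  ultimately have "p0 \<noteq> 0 \<and> app p0 = 0" using c(2) by simp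
  from ex_has_least_nat[of "\<lambda>p. p \<noteq> 0 \<and> app p = 0", OF this, of degree]
  obtain p where p: "p \<noteq> 0" "app p = 0" and least: "\<And>q. q \<noteq> 0 \<Longrightarrow> app q = 0 \<Longrightarrow> degree p \<le> degree q"
    by blast
  have "degree p \<noteq> 0"
  proof
    assume "degree p = 0"
    then obtain a where "p = [:a:]" by (meson degree_eq_zeroE)
    with p assms(2) show False by (auto simp: app_def K_def vec_eq_iff)
  qed
  then have "\<not> constant (poly p)" by (simp add: constant_degree)
  then obtain z where "poly p z = 0" using fundamental_theorem_of_algebra by blast
  then obtain q where q: "p = [:-z, 1:] * q" by (auto simp: poly_eq_0_iff_dvd)
  with p have "q \<noteq> 0" by auto
  then have deg: "degree p = Suc (degree q)" unfolding q by (subst degree_mult_eq) auto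
  with least \<open>q \<noteq> 0\<close> have "app q \<noteq> 0" by fastforce
  \<comment> \<open>The coefficients of \<open>p\<close> are those of \<open>x q\<close> minus those
    of \<open>z q\<close>. Under \<open>app\<close>, multiplication by \<open>x\<close> shifts
    \<open>K m\<close> to \<open>K (Suc m)\<close> and so becomes application of
    \<open>A\<close>.\<close>
  have "app p = (\<Sum>m\<le>Suc (degree q). coeff (pCons 0 q) m *s K m) - (\<Sum>m\<le>Suc (degree q). (z * coeff q m) *s K m)"
    unfolding app_def deg sum_subtractf[symmetric] by (intro sum.cong) (auto simp: q vec_eq_iff algebra_simps)
  also have "(\<Sum>m\<le>Suc (degree q). coeff (pCons 0 q) m *s K m) = (\<Sum>m\<le>degree q. coeff q m *s K (Suc m))"
    by (subst sum.atMost_Suc_shift) (simp add: vec_eq_iff)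
  also have "\<dots> = A *v app q"
    by (simp add: app_def matrix_vector_mult_sum vector_scalar_commute K_def)
  also have "(\<Sum>m\<le>Suc (degree q). (z * coeff q m) *s K m) = z *s app q"
    by (subst app_eq[of q "Suc (degree q)"]) (auto simp: vec_eq_iff sum_distrib_left mult.assoc)
  finally have "A *v app q = z *s app q" using p(2) by simp
  with appS \<open>app q \<noteq> 0\<close> show ?thesis using that by blast
qed

text \<open>The Hermitian product, conjugate-linear in the first argument. Orthogonality has to be
  complex, and \<open>\<bullet>\<close> gives only the real part.\<close>

definition hip :: "complex^'n \<Rightarrow> complex^'n \<Rightarrow> complex" where
  "hip x y = (\<Sum>i\<in>UNIV. cnj (x $ i) * y $ i)"

lemma hip_simps: "hip x (y + y') = hip x y + hip x y'" "hip x (c *s y) = c * hip x y"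
  "hip (c *s x) y = cnj c * hip x y" "hip x 0 = 0" "cnj (hip x y) = hip y x"
  by (simp_all add: hip_def algebra_simps sum.distrib sum_distrib_left)

lemma hip_self: "hip x x = of_real ((norm x)\<^sup>2)"
proof -
  have "hip x x = (\<Sum>i\<in>UNIV. of_real ((cmod (x $ i))\<^sup>2))"
    unfolding hip_def by (intro sum.cong refl) (metis complex_norm_square mult.commute)
  also have "\<dots> = of_real ((norm x)\<^sup>2)"
    by (simp add: norm_vec_def L2_set_def sum_nonneg)
  finally show ?thesis .
qed

lemma hip_adj: "hip x (A *v y) = hip (adj A *v x) y"
proof -
  have "hip x (A *v y) = (\<Sum>i\<in>UNIV. \<Sum>j\<in>UNIV. cnj (x $ i) * A $ i $ j * y $ j)"
    by (simp add: hip_def matrix_vector_mult_def sum_distrib_left mult.assoc)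
  also have "\<dots> = (\<Sum>j\<in>UNIV. \<Sum>i\<in>UNIV. cnj (x $ i) * A $ i $ j * y $ j)" by (rule sum.swap)
  finally show ?thesis by (simp add: hip_def matrix_vector_mult_def sum_distrib_right sum_distrib_left mult_ac)
qed

text \<open>The orthogonal complement of the eigenvectors found so far is nonzero and invariant
  under \<open>A\<close>, hence contains a further eigenvector. The vectors are labelled by a subset
  of the index type, so that a full system is the column family of a square matrix.\<close>

lemma unitary_orthonormal_eigenvectors:
  fixes A :: "complex^'n^'n"
  assumes "unitary_matrix A" "m \<le> CARD('n)"
  shows "\<exists>B v d. card B = m \<and> (\<forall>a\<in>B. A *v v a = d a *s v a) \<and>
    (\<forall>a\<in>B. \<forall>b\<in>B. hip (v a) (v b) = (if a = (b::'n) then 1 else 0))"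
  using assms(2)
proof (induction m)
  case 0
  then show ?case by (intro exI[of _ "{}"]) auto
next
  case (Suc m)
  then obtain B v d where "card B = m \<and> (\<forall>a\<in>B. A *v v a = d a *s v a) \<and>
      (\<forall>a\<in>B. \<forall>b\<in>B. hip (v a) (v b) = (if a = (b::'n) then 1 else 0))"
    using Suc_leD by blast
  then have B: "card B = m" "\<And>a. a \<in> B \<Longrightarrow> A *v v a = d a *s v a"
    "\<And>a b. a \<in> B \<Longrightarrow> b \<in> B \<Longrightarrow> hip (v a) (v b) = (if a = b then 1 else 0)"
    by simp_all
  with Suc.prems have "B \<noteq> UNIV" by auto
  then obtain b where b: "b \<notin> B" by blast
  define C where "C = (\<chi> a. if a \<in> B then (\<chi> j. cnj (v a $ j)) else 0)"
  have "row b C = 0" using b by (simp add: row_def C_def vec_eq_iff)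
  then have "det C = 0" by (rule det_zero_row)
  then have "\<not> invertible C" by (simp add: invertible_det_nz)
  then obtain w where w: "w \<noteq> 0" "C *v w = 0"
    by (auto simp: invertible_left_inverse matrix_left_invertible_ker)
  define S where "S = {u. \<forall>a\<in>B. hip (v a) u = 0}"
  have "w \<in> S"
  proof -
    have "hip (v a) w = (C *v w) $ a" if "a \<in> B" for a
      using that by (simp add: hip_def C_def matrix_vector_mult_def)
    with w show ?thesis by (simp add: S_def)
  qed
  have inv: "A *v x \<in> S" if "x \<in> S" for x
    unfolding S_def
  proof (intro CollectI ballI)
    fix a assume a: "a \<in> B"
    \<comment> \<open>Unitarity makes \<open>v a\<close> an eigenvector of \<open>adj A\<close> as
      well, which is what keeps its orthogonal complement invariant under \<open>A\<close>.\<close>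
    have "v a = adj A *v (A *v v a)"
      by (simp add: matrix_vector_mul_assoc unitary_matrix_mult[OF assms(1)])
    also have "\<dots> = d a *s (adj A *v v a)" by (simp add: B(2)[OF a] vector_scalar_commute)
    finally have e: "v a = d a *s (adj A *v v a)" .
    have "d a \<noteq> 0"
    proof
      assume "d a = 0"
      then have "v a = 0" using e by simp
      then show False using B(3)[OF a a] by (simp add: hip_def)
    qed
    moreover have "0 = cnj (d a) * hip (adj A *v v a) x"
      using that a e by (metis (mono_tags, lifting) S_def hip_simps(3) mem_Collect_eq)
    ultimately show "hip (v a) (A *v x) = 0" by (simp add: hip_adj)
  qed
  obtain u z where u: "u \<in> S" "u \<noteq> 0" "A *v u = z *s u"
    using eigenvector_in_invariant_set[of w S A] \<open>w \<in> S\<close> w(1) inv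
    by (auto simp: S_def hip_simps)
  define u' where "u' = complex_of_real (1 / norm u) *s u"
  have "hip u' u' = 1"
  proof -
    have "hip u' u' = cnj (complex_of_real (1 / norm u)) * (complex_of_real (1 / norm u) * hip u u)"
      by (simp only: u'_def hip_simps mult_ac)
    then show ?thesis using u(2) by (simp add: hip_self power2_eq_square)
  qed
  moreover have u': "A *v u' = z *s u'" "\<And>a. a \<in> B \<Longrightarrow> hip (v a) u' = 0"
    using u by (auto simp: u'_def vector_scalar_commute hip_simps S_def vec_eq_iff)
  moreover have "hip u' (v a) = 0" if "a \<in> B" for a using u'(2)[OF that] by (metis hip_simps(5) complex_cnj_zero)
  ultimately show ?case using b B
    by (intro exI[of _ "insert b B"] exI[of _ "v(b := u')"] exI[of _ "d(b := z)"]) auto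
qed

lemma unitary_diagonalization:
  fixes A :: "complex^'n^'n"
  assumes "unitary_matrix A"
  obtains V d where "unitary_matrix V" "A = V ** diag d ** adj V"
proof -
  obtain B v d where "card B = CARD('n) \<and> (\<forall>a\<in>B. A *v v a = d a *s v a) \<and>
      (\<forall>a\<in>B. \<forall>b\<in>B. hip (v a) (v b) = (if a = (b::'n) then 1 else 0))"
    using unitary_orthonormal_eigenvectors[OF assms, of "CARD('n)"] by blast
  then have B: "card B = CARD('n)" "\<And>a. a \<in> B \<Longrightarrow> A *v v a = d a *s v a"
    "\<And>a b. a \<in> B \<Longrightarrow> b \<in> B \<Longrightarrow> hip (v a) (v b) = (if a = b then 1 else 0)"
    by simp_all
  have [simp]: "B = UNIV" using B(1) by (simp add: card_subset_eq)
  define V :: "complex^'n^'n" where "V = (\<chi> i a. v a $ i)"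
  have "adj V ** V = mat 1"
    using B(3) by (simp add: vec_eq_iff V_def matrix_matrix_mult_def hip_def mat_def)
  then have V: "unitary_matrix V" by (simp add: unitary_matrix_def matrix_left_right_inverse)
  have "A ** V = V ** diag d"
    using B(2) by (simp add: vec_eq_iff mult_diag_component)
      (simp add: matrix_matrix_mult_def matrix_vector_mult_def V_def mult.commute)
  then have "A = V ** diag d ** adj V"
    by (metis V matrix_mul_assoc matrix_mul_rid unitary_matrix_def)
  with V that show ?thesis by blast
qed

section \<open>Eigenvalues and multiplicities read off from a diagonalisation\<close>

lemma matrix_diff_distrib:
  fixes A :: "'a::comm_ring_1^'n^'n"
  shows "A ** (B - C) = A ** B - A ** C" "(B - C) ** A = B ** A - C ** A"
  by (simp_all add: vec_eq_iff matrix_matrix_mult_def sum_subtractf algebra_simps)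

text \<open>The similarity is carried out over the polynomial ring: \<open>c\<close> embeds matrices
  as constant polynomial matrices and respects products, and the scalar matrix \<open>x\<close>
  commutes with everything.\<close>

lemma charpoly_diagonalization:
  fixes V :: "complex^'n^'n"
  assumes "unitary_matrix V"
  shows "charpoly (V ** diag d ** adj V) = (\<Prod>a\<in>UNIV. [:- d a, 1:])"
proof -
  define c :: "complex^'n^'n \<Rightarrow> complex poly^'n^'n" where "c M = (\<chi> i j. [:M $ i $ j:])" for M
  have c_mult: "c (M ** M') = c M ** c M'" for M M'
    by (simp add: c_def vec_eq_iff matrix_matrix_mult_def mult.commute flip: sum_to_poly)
  have c1: "c (mat 1) = mat 1" by (simp add: c_def vec_eq_iff mat_def one_pCons)
  define x where "x = (mat [:0, 1:] :: complex poly^'n^'n)"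
  have "charpoly M = det (x - c M)" for M :: "complex^'n^'n"
    unfolding charpoly_def by (rule arg_cong[of _ _ det]) (simp add: vec_eq_iff x_def c_def mat_def)
  also have "x - c (V ** diag d ** adj V) = c V ** (x - c (diag d)) ** c (adj V)"
  proof -
    have "c V ** x ** c (adj V) = x ** c (V ** adj V)"
      by (simp add: c_mult x_def mat_mult_commute[symmetric] matrix_mul_assoc)
    also have "\<dots> = x" using assms by (simp add: unitary_matrix_def c1)
    finally show ?thesis by (simp add: c_mult matrix_diff_distrib)
  qed
  also have "det \<dots> = det (x - c (diag d)) * det (c (V ** adj V))"
    by (simp add: det_mul c_mult)
  also have "c (V ** adj V) = mat 1" using assms by (simp add: unitary_matrix_def c1)
  also have "det (x - c (diag d)) = (\<Prod>a\<in>UNIV. [:- d a, 1:])"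
    by (subst det_diagonal) (auto simp: x_def c_def mat_def diag_def)
  finally show ?thesis by simp
qed

lemma order_prod_linear:
  fixes d :: "'b \<Rightarrow> complex"
  shows "finite S \<Longrightarrow> order z (\<Prod>a\<in>S. [:- d a, 1:]) = card {a\<in>S. d a = z}"
proof (induction S rule: finite_induct)
  case (insert b S)
  have nz: "(\<Prod>a\<in>S. [:- d a, 1:]) \<noteq> 0" using insert by simp
  have o: "order z [:- d b, 1:] = (if d b = z then 1 else 0)"
    using order_power_n_n[of z 1] by (auto intro: order_0I)
  have "{a\<in>insert b S. d a = z} = (if d b = z then insert b {a\<in>S. d a = z} else {a\<in>S. d a = z})"
    by auto
  moreover have "[:- d b, 1:] * (\<Prod>a\<in>S. [:- d a, 1:]) \<noteq> 0"
    using nz by (metis mult_eq_0_iff one_neq_zero pCons_eq_0_iff)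
  ultimately show ?case using insert by (simp add: order_mult o del: mult_pCons_left)
qed simp

lemma multiplicity_diagonalization:
  fixes V :: "complex^'n^'n"
  assumes "unitary_matrix V"
  shows "multiplicity_eigenvalue (V ** diag d ** adj V) z = card {a. d a = z}"
  by (simp add: multiplicity_eigenvalue_def charpoly_diagonalization[OF assms] order_prod_linear)

lemma eigenvalue_diagonalization:
  fixes V :: "complex^'n^'n"
  assumes "unitary_matrix V"
  shows "eigenvalue (V ** diag d ** adj V) z \<longleftrightarrow> z \<in> range d"
proof
  assume "eigenvalue (V ** diag d ** adj V) z"
  then obtain v where v: "v \<noteq> 0" "(V ** diag d ** adj V) *v v = z *s v" by (auto simp: eigenvalue_def)
  define w where "w = adj V *v v"
  have "v = V *v w"
    by (simp add: w_def matrix_vector_mul_assoc unitary_matrix_mult[OF assms])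
  then have "w \<noteq> 0" using v(1) by auto
  have "diag d *v w = adj V *v ((V ** diag d ** adj V) *v v)"
    by (simp add: w_def matrix_vector_mul_assoc matrix_mul_assoc unitary_matrix_mult[OF assms])
  also have "\<dots> = z *s w" by (simp add: v(2) w_def vector_scalar_commute)
  finally have "diag d *v w = z *s w" .
  moreover obtain a where "w $ a \<noteq> 0" using \<open>w \<noteq> 0\<close> by (auto simp: vec_eq_iff)
  moreover have "(diag d *v w) $ a = d a * w $ a"
    by (simp add: diag_def matrix_vector_mult_def if_distrib[of "\<lambda>x. x * _"] cong: if_cong)
  ultimately have "d a = z" by simp
  then show "z \<in> range d" by auto
next
  assume "z \<in> range d"
  then obtain a where a: "z = d a" by auto
  define v where "v = V *v axis a 1"
  have *: "adj V *v v = axis a 1"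
    by (simp add: v_def matrix_vector_mul_assoc unitary_matrix_mult[OF assms])
  then have "v \<noteq> 0" by (metis axis_eq_0_iff matrix_vector_mult_0_right zero_neq_one)
  moreover have "diag d *v axis a 1 = z *s axis a 1"
    by (auto simp: diag_def matrix_vector_mult_def axis_def vec_eq_iff a if_distrib[of "\<lambda>x. x * _"] cong: if_cong)
  then have "(V ** diag d ** adj V) *v v = z *s v"
    by (simp add: * v_def vector_scalar_commute flip: matrix_vector_mul_assoc)
      (metis "*" v_def vector_scalar_commute)
  ultimately show "eigenvalue (V ** diag d ** adj V) z" by (auto simp: eigenvalue_def)
qed

section \<open>Orthogonal resolutions of the identity\<close>

text \<open>A spectral resolution of \<open>A\<close>. Values \<open>\<mu> i\<close> may coincide
  and some \<open>Q i\<close> may vanish; lemmas for which this matters say so.\<close>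

definition resolution :: "nat \<Rightarrow> (nat \<Rightarrow> complex) \<Rightarrow> (nat \<Rightarrow> complex^'n^'n) \<Rightarrow> complex^'n^'n \<Rightarrow> bool" where
  "resolution I \<mu> Q A \<longleftrightarrow> (\<forall>i\<in>{1..I}. adj (Q i) = Q i) \<and>
     (\<forall>i\<in>{1..I}. \<forall>j\<in>{1..I}. Q i ** Q j = (if i = j then Q i else 0)) \<and>
     (\<Sum>i=1..I. Q i) = mat 1 \<and> A = (\<Sum>i=1..I. mat (\<mu> i) ** Q i)"

lemma resolutionD:
  assumes "resolution I \<mu> Q A"
  shows "i \<in> {1..I} \<Longrightarrow> adj (Q i) = Q i" "i \<in> {1..I} \<Longrightarrow> Q i ** Q i = Q i"
    "i \<in> {1..I} \<Longrightarrow> j \<in> {1..I} \<Longrightarrow> i \<noteq> j \<Longrightarrow> Q i ** Q j = 0"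
    "(\<Sum>i=1..I. Q i) = mat 1" "A = (\<Sum>i=1..I. mat (\<mu> i) ** Q i)"
  using assms unfolding resolution_def by auto

lemma resolution_eigen:
  assumes "resolution I \<mu> Q A" "i \<in> {1..I}"
  shows "A ** Q i = mat (\<mu> i) ** Q i" "Q i ** A = mat (\<mu> i) ** Q i"
proof -
  note R = resolutionD[OF assms(1)]
  have "A ** Q i = (\<Sum>j=1..I. mat (\<mu> j) ** (Q j ** Q i))"
    by (subst R(5)) (simp add: mm.sum_left mm_assoc)
  also have "\<dots> = (\<Sum>j=1..I. if j = i then mat (\<mu> i) ** Q i else 0)"
    using assms(2) R(2,3) by (intro sum.cong) auto
  finally show "A ** Q i = mat (\<mu> i) ** Q i" using assms(2) by simp
  have "Q i ** A = (\<Sum>j=1..I. mat (\<mu> j) ** (Q i ** Q j))"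
    by (subst R(5)) (simp add: mm.sum_right mat_mult_left_commute)
  also have "\<dots> = (\<Sum>j=1..I. if j = i then mat (\<mu> i) ** Q i else 0)"
    using assms(2) R(2,3) by (intro sum.cong) auto
  finally show "Q i ** A = mat (\<mu> i) ** Q i" using assms(2) by simp
qed

lemma resolution_split:
  assumes "resolution I \<mu> Q A"
  shows "(\<Sum>i=1..I. Q i ** B) = B" "(\<Sum>i=1..I. B ** Q i) = B"
  using resolutionD(4)[OF assms] by (simp_all add: mm.sum_left[symmetric] mm.sum_right[symmetric])

text \<open>\<open>A\<close> acts on \<open>Q i\<close> as \<open>\<mu> i\<close> and
  \<open>B\<close> acts on \<open>E j\<close> as \<open>\<nu> j\<close>. Hence
  \<open>E j ** Q i\<close> must be small when \<open>A - B\<close> is small and the two eigenvalues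
  are apart; the perturbation estimates all rest on this.\<close>

lemma resolution_cross:
  assumes "resolution I \<mu> Q A" "resolution J \<nu> E B" "i \<in> {1..I}" "j \<in> {1..J}"
  shows "E j ** (A - B) ** Q i = mat (\<mu> i - \<nu> j) ** (E j ** Q i)"
proof -
  have "E j ** (A - B) ** Q i = E j ** (A ** Q i) - (E j ** B) ** Q i"
    by (simp add: mm_distribs mm_assoc)
  also have "\<dots> = E j ** (mat (\<mu> i) ** Q i) - (mat (\<nu> j) ** E j) ** Q i"
    using resolution_eigen[OF assms(1,3)] resolution_eigen[OF assms(2,4)] by simp
  also have "\<dots> = mat (\<mu> i - \<nu> j) ** (E j ** Q i)"
    by (simp add: mat_mult_left_commute mm_assoc mat_diff mm_distribs)
  finally show ?thesis .
qed

lemma resolution_unitary: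
  assumes "resolution I \<mu> Q A" "\<And>i. i \<in> {1..I} \<Longrightarrow> cmod (\<mu> i) = 1"
  shows "unitary_matrix A"
proof -
  note R = resolutionD[OF assms(1)]
  have "adj A = (\<Sum>i=1..I. mat (cnj (\<mu> i)) ** Q i)"
    by (subst R(5)) (auto simp: adj_sum adj_mult R(1) mat_mult_commute intro!: sum.cong)
  then have "A ** adj A = (\<Sum>i=1..I. mat (cnj (\<mu> i)) ** (A ** Q i))"
    by (simp add: mm.sum_right mat_mult_left_commute)
  also have "\<dots> = (\<Sum>i=1..I. Q i)"
  proof (intro sum.cong refl)
    fix i assume i: "i \<in> {1..I}"
    have "mat (cnj (\<mu> i)) ** (A ** Q i) = mat (cnj (\<mu> i) * \<mu> i) ** Q i"
      by (simp add: resolution_eigen[OF assms(1) i] matrix_mul_assoc mat_mult_mat)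
    also have "cnj (\<mu> i) * \<mu> i = 1"
      using assms(2)[OF i] complex_norm_square[of "\<mu> i"] by (simp add: mult.commute)
    finally show "mat (cnj (\<mu> i)) ** (A ** Q i) = Q i" by simp
  qed
  finally show ?thesis unfolding unitary_matrix_def R(4) .
qed

lemma resolution_conj:
  assumes "resolution I \<mu> Q A" "unitary_matrix V"
  shows "resolution I \<mu> (\<lambda>i. V ** Q i ** adj V) (V ** A ** adj V)"
proof -
  note R = resolutionD[OF assms(1)]
  have mult: "V ** Q i ** adj V ** (V ** Q j ** adj V) = V ** (Q i ** Q j) ** adj V" for i j
    by (simp add: mm_assoc unitary_matrix_cancel[OF assms(2)])
  have "(\<Sum>i=1..I. V ** Q i ** adj V) = V ** (\<Sum>i=1..I. Q i) ** adj V"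
    by (simp add: mm.sum_left mm.sum_right)
  then have "(\<Sum>i=1..I. V ** Q i ** adj V) = mat 1"
    unfolding R(4) by (simp add: unitary_matrix_mult[OF assms(2)])
  moreover have "V ** A ** adj V = (\<Sum>i=1..I. mat (\<mu> i) ** (V ** Q i ** adj V))"
    by (subst R(5)) (simp add: mm.sum_left mm.sum_right mm_assoc mat_mult_left_commute)
  moreover have "adj (V ** Q i ** adj V) = V ** Q i ** adj V" if "i \<in> {1..I}" for i
    using R(1)[OF that] by (simp add: adj_mult mm_assoc)
  ultimately show ?thesis
    unfolding resolution_def mult using R(2,3) by auto
qed

lemma resolution_diag:
  fixes l :: "nat \<Rightarrow> complex" and c :: "'n::finite \<Rightarrow> nat"
  assumes "\<And>a. c a \<in> {1..I}"
  shows "resolution I l (\<lambda>i. proj {a. c a = i}) (diag (\<lambda>a. l (c a)))"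
proof -
  have "(\<Sum>i=1..I. indicator {a. c a = i} a) = (1::complex)" for a
    using assms[of a] by (simp add: indicator_def of_bool_def)
  moreover have "(\<Sum>i=1..I. l i * indicator {a. c a = i} a) = l (c a)" for a
    using assms[of a] by (simp add: indicator_def of_bool_def if_distrib[of "\<lambda>x. _ * x"] cong: if_cong)
  moreover have "proj ({a. c a = i} \<inter> {a. c a = j}) = (if i = j then proj {a. c a = i} else 0)" for i j
    by (auto simp: vec_eq_iff proj_component)
  ultimately show ?thesis
    by (simp add: resolution_def proj_mult) (simp add: proj_def diag_sum diag_const[symmetric] diag_mult)
qed

lemma resolution_reindex:
  assumes "resolution I \<mu> Q A" "\<sigma> ` {1..I} \<subseteq> {1..I}" "inj_on \<sigma> {1..I}"
  shows "resolution I (\<mu> \<circ> \<sigma>) (Q \<circ> \<sigma>) A"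
proof -
  note R = resolutionD[OF assms(1)]
  have "\<sigma> ` {1..I} = {1..I}" using assms(2,3) by (intro endo_inj_surj) auto
  then have "(\<Sum>i=1..I. g (\<sigma> i)) = (\<Sum>i=1..I. g i)" for g :: "nat \<Rightarrow> complex^'a^'a"
    using sum.reindex[OF assms(3), of g] by simp
  from this[of Q] this[of "\<lambda>i. mat (\<mu> i) ** Q i"] show ?thesis
    using assms(1) assms(2) inj_onD[OF assms(3)] unfolding resolution_def o_def
    by (auto simp: image_subset_iff)
qed

section \<open>Perturbation estimates for spectral resolutions\<close>

lemma mat_of_real_mult: "mat (complex_of_real r) ** A = r *\<^sub>R A"
  by (simp add: vec_eq_iff mat_mult_component scaleR_conv_of_real[where 'a=complex])

lemma norm_mat_mult: "norm (mat z ** A) = cmod z * norm (A::complex^'n^'n)"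
proof -
  have "(mat z ** A) \<bullet> (mat z ** A) = A \<bullet> (mat (cnj z * z) ** A)"
    by (simp add: inner_mult_left matrix_mul_assoc mat_mult_mat)
  also have "cnj z * z = complex_of_real ((cmod z)\<^sup>2)" using complex_norm_square[of z] by (simp add: mult.commute)
  also have "A \<bullet> (mat \<dots> ** A) = (cmod z * norm A)\<^sup>2"
    by (simp only: mat_of_real_mult) (simp add: power_mult_distrib dot_square_norm)
  finally have "(norm (mat z ** A))\<^sup>2 = (cmod z * norm A)\<^sup>2" by (simp add: dot_square_norm)
  then show ?thesis by (simp add: power2_eq_iff_nonneg)
qed

lemma resolution_cross_norm:
  assumes "resolution I \<mu> Q A" "resolution J \<nu> E B" "i \<in> {1..I}" "j \<in> {1..J}"
    "\<delta> > 0" "cmod (\<mu> i - \<nu> j) \<ge> \<delta>"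
  shows "norm (E j ** Q i) \<le> norm (A - B) / \<delta>"
proof -
  have "\<delta> * norm (E j ** Q i) \<le> norm (mat (\<mu> i - \<nu> j) ** (E j ** Q i))"
    using assms(5,6) by (simp add: norm_mat_mult mult_right_mono)
  also have "\<dots> = norm (E j ** (A - B) ** Q i)" by (simp add: resolution_cross[OF assms(1-4)])
  also have "\<dots> \<le> norm (E j ** (A - B))"
    using resolutionD[OF assms(1)] assms(3) by (intro norm_projection_mult_le)
  also have "\<dots> \<le> norm (A - B)"
    using resolutionD[OF assms(2)] assms(4) by (intro norm_projection_mult_le)
  finally show ?thesis using assms(5) by (simp add: field_simps)
qed

text \<open>If every \<open>\<mu> i\<close> were far from \<open>\<nu> j\<close>, all products
  \<open>E j ** Q i\<close> would be small, although they add up to \<open>E j\<close>.\<close>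

lemma resolution_eigenvalue_near:
  assumes "resolution I \<mu> Q A" "resolution J \<nu> E B" "j \<in> {1..J}" "\<epsilon> > 0"
    "norm (A - B) * I < \<epsilon> * norm (E j)"
  shows "\<exists>i\<in>{1..I}. cmod (\<mu> i - \<nu> j) < \<epsilon>"
proof (rule ccontr)
  assume "\<not> ?thesis"
  then have "norm (E j ** Q i) \<le> norm (A - B) / \<epsilon>" if "i \<in> {1..I}" for i
    using that assms by (intro resolution_cross_norm) (auto simp: not_less)
  then have "norm (\<Sum>i=1..I. E j ** Q i) \<le> (\<Sum>i=1..I. norm (A - B) / \<epsilon>)"
    by (intro sum_norm_le) auto
  then have "norm (E j) \<le> I * (norm (A - B) / \<epsilon>)"
    using resolution_split(2)[OF assms(1), of "E j"] by simp
  then show False using assms(4,5) by (simp add: field_simps)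
qed

text \<open>\<open>E i ** Q i\<close> is compared with both \<open>Q i\<close> and
  \<open>E i\<close>: either difference is a sum of fewer than \<open>I\<close> cross terms, each at
  most \<open>norm (A - B) / \<delta>\<close>. This explains the factor
  \<open>2 * I / \<delta>\<close>.\<close>

lemma resolution_close:
  assumes Q: "resolution I \<mu> Q A" and E: "resolution I \<nu> E B" and "\<delta> > 0"
    and sep: "\<And>i j. i \<in> {1..I} \<Longrightarrow> j \<in> {1..I} \<Longrightarrow> i \<noteq> j \<Longrightarrow> cmod (\<mu> i - \<nu> j) \<ge> \<delta>"
    and i: "i \<in> {1..I}"
  shows "norm (Q i - E i) \<le> 2 * real I / \<delta> * norm (A - B)"
proof -
  define C where "C = norm (A - B) / \<delta>"
  have cross: "norm (E k ** Q j) \<le> C" if "j \<in> {1..I}" "k \<in> {1..I}" "j \<noteq> k" for j k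
    unfolding C_def using that assms by (intro resolution_cross_norm[OF Q E]) auto
  have C: "C \<ge> 0" using assms(3) by (simp add: C_def)
  have "Q i = E i ** Q i + (\<Sum>j\<in>{1..I} - {i}. E j ** Q i)"
    using resolution_split(1)[OF E, of "Q i"] sum.remove[OF _ i, of "\<lambda>j. E j ** Q i"] by simp
  then have "norm (Q i - E i ** Q i) = norm (\<Sum>j\<in>{1..I} - {i}. E j ** Q i)" by (metis add_diff_cancel_left')
  also have "\<dots> \<le> (\<Sum>j\<in>{1..I} - {i}. C)" using cross i by (intro sum_norm_le) auto
  also have "\<dots> \<le> I * C" using C i by (auto intro!: mult_right_mono)
  finally have 1: "norm (Q i - E i ** Q i) \<le> I * C" .
  have "E i = E i ** Q i + (\<Sum>j\<in>{1..I} - {i}. E i ** Q j)"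
    using resolution_split(2)[OF Q, of "E i"] sum.remove[OF _ i, of "\<lambda>j. E i ** Q j"] by simp
  then have "norm (E i - E i ** Q i) = norm (\<Sum>j\<in>{1..I} - {i}. E i ** Q j)" by (metis add_diff_cancel_left')
  also have "\<dots> \<le> (\<Sum>j\<in>{1..I} - {i}. C)" using cross i by (intro sum_norm_le) auto
  also have "\<dots> \<le> I * C" using C i by (auto intro!: mult_right_mono)
  finally have 2: "norm (E i - E i ** Q i) \<le> I * C" .
  have "norm (Q i - E i) \<le> norm (Q i - E i ** Q i) + norm (E i - E i ** Q i)"
    using norm_triangle_ineq4[of "Q i - E i ** Q i" "E i - E i ** Q i"] by simp
  also have "\<dots> \<le> 2 * (I * C)" using 1 2 by simp
  also have "\<dots> = 2 * real I / \<delta> * norm (A - B)" by (simp add: C_def)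
  finally show ?thesis .
qed

lemma resolution_unique:
  assumes Q: "resolution I \<mu> Q A" and E: "resolution I \<mu> E A" and inj: "inj_on \<mu> {1..I}"
    and i: "i \<in> {1..I}"
  shows "Q i = E i"
proof -
  have orth: "E k ** Q j = 0" if "j \<in> {1..I}" "k \<in> {1..I}" "j \<noteq> k" for j k
    using resolution_cross[OF Q E that(1,2)] that inj_onD[OF inj] by (auto simp: mat_eq_0_iff)
  have "Q i = E i ** Q i"
    using resolution_split(1)[OF E, of "Q i"] sum.remove[OF _ i, of "\<lambda>j. E j ** Q i"] orth i by simp
  also have "\<dots> = E i"
    using resolution_split(2)[OF Q, of "E i"] sum.remove[OF _ i, of "\<lambda>j. E i ** Q j"] orth i by simp
  finally show ?thesis .
qed

text \<open>Normal form of the elements of the set: the colouring \<open>c\<close> records which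
  eigenvalue stands at each diagonal position, so multiplicities become sizes of colour
  classes.\<close>

lemma unitary_with_multiplicities_diagonalization:
  fixes A :: "complex^'n^'n"
  assumes "A \<in> unitary_with_multiplicities I k"
  obtains V and c :: "'n \<Rightarrow> nat" and l where "unitary_matrix V" "\<And>a. c a \<in> {1..I}"
    "\<And>i. i \<in> {1..I} \<Longrightarrow> card {a. c a = i} = k i" "inj_on l {1..I}"
    "\<And>i. i \<in> {1..I} \<Longrightarrow> cmod (l i) = 1" "A = V ** diag (\<lambda>a. l (c a)) ** adj V"
proof -
  obtain l where A: "unitary_matrix A" and l: "inj_on l {1..I}" "{z. eigenvalue A z} = l ` {1..I}"
    "\<And>i. i \<in> {1..I} \<Longrightarrow> multiplicity_eigenvalue A (l i) = k i"
    using assms unfolding unitary_with_multiplicities_def by auto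
  obtain V d where V: "unitary_matrix V" and Ad: "A = V ** diag d ** adj V"
    using unitary_diagonalization[OF A] .
  have rd: "range d = l ` {1..I}"
    using l(2) eigenvalue_diagonalization[OF V, of d] by (auto simp: Ad)
  define c where "c a = inv_into {1..I} l (d a)" for a
  have c: "c a \<in> {1..I}" "l (c a) = d a" for a
  proof -
    have "d a \<in> l ` {1..I}" using rd by blast
    then show "c a \<in> {1..I}" "l (c a) = d a"
      unfolding c_def by (rule inv_into_into, rule f_inv_into_f)
  qed
  have "{a. c a = i} = {a. d a = l i}" if "i \<in> {1..I}" for i
    using c inj_onD[OF l(1)] that by metis
  then have card: "card {a. c a = i} = k i" if "i \<in> {1..I}" for i
    using l(3)[OF that] that by (simp add: Ad multiplicity_diagonalization[OF V])
  have "diag d = adj V ** A ** V"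
    by (simp add: Ad mm_assoc unitary_matrix_cancel[OF V] unitary_matrix_mult[OF V])
  then have "unitary_matrix (diag d)"
    using unitary_matrix_times[OF unitary_matrix_times[OF unitary_matrix_adj[OF V] A] V] by simp
  then have "(diag d ** adj (diag d)) $ a $ a = 1" for a
    by (simp add: unitary_matrix_def mat_def)
  then have "d a * cnj (d a) = 1" for a
    by (simp add: adj_diag diag_mult diag_component)
  then have "(cmod (d a))\<^sup>2 = 1" for a
    using complex_norm_square[of "d a"] by (metis of_real_1 of_real_eq_iff)
  then have "cmod (d a) = 1" for a
    using norm_ge_zero[of "d a"] power2_eq_1_iff[of "cmod (d a)"] by (metis le_minus_one_simps(3))
  then have "cmod (l i) = 1" if "i \<in> {1..I}" for i using rd that by (metis imageE imageI)
  moreover have "A = V ** diag (\<lambda>a. l (c a)) ** adj V" by (simp add: Ad c(2))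
  ultimately show ?thesis using that V c(1) card l(1) by blast
qed

text \<open>Diagonalising \<open>A\<close> and grouping the positions by eigenvalue gives a second
  resolution with the same distinct values. By uniqueness it is \<open>Q\<close>, so the traces
  count the positions; positive traces ensure that every \<open>\<mu> i\<close> really
  occurs.\<close>

lemma resolution_imp_unitary_with_multiplicities:
  fixes A :: "complex^'n^'n"
  assumes Q: "resolution I \<mu> Q A" and \<mu>: "\<And>i. i \<in> {1..I} \<Longrightarrow> cmod (\<mu> i) = 1" "inj_on \<mu> {1..I}"
    and k: "\<And>i. i \<in> {1..I} \<Longrightarrow> k i > 0" "\<And>i. i \<in> {1..I} \<Longrightarrow> trace (Q i) = of_nat (k i)"
  shows "A \<in> unitary_with_multiplicities I k"
proof -
  have A: "unitary_matrix A" by (rule resolution_unitary[OF Q \<mu>(1)])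
  obtain V d where V: "unitary_matrix V" and Ad: "A = V ** diag d ** adj V"
    using unitary_diagonalization[OF A] .
  have ev: "{z. eigenvalue A z} = range d" using eigenvalue_diagonalization[OF V, of d] by (auto simp: Ad)
  have "range d \<subseteq> \<mu> ` {1..I}"
  proof
    fix z assume "z \<in> range d"
    with ev obtain v where v: "v \<noteq> 0" "A *v v = z *s v" by (auto simp: eigenvalue_def)
    have "\<exists>i\<in>{1..I}. Q i *v v \<noteq> 0"
    proof (rule ccontr)
      assume "\<not> ?thesis"
      moreover have "v = (\<Sum>i=1..I. Q i) *v v" unfolding resolutionD(4)[OF Q] by simp
      moreover have "(\<Sum>i\<in>S. Q i) *v v = (\<Sum>i\<in>S. Q i *v v)" for S
        by (induction S rule: infinite_finite_induct) (auto simp: matrix_vector_mult_add_rdistrib)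
      ultimately show False using v(1) by simp
    qed
    then obtain i where i: "i \<in> {1..I}" "Q i *v v \<noteq> 0" by blast
    have "z *s (Q i *v v) = Q i *v (A *v v)" by (simp add: v(2) vector_scalar_commute)
    also have "\<dots> = mat (\<mu> i) *v (Q i *v v)"
      using resolution_eigen(2)[OF Q i(1)] by (simp add: matrix_vector_mul_assoc)
    also have "\<dots> = \<mu> i *s (Q i *v v)"
      by (simp add: vec_eq_iff mat_def matrix_vector_mult_def[where x="Q i *v v"]
          if_distrib[of "\<lambda>x. x * _"] cong: if_cong)
    finally have "z = \<mu> i" using i(2) by (metis vector_mul_rcancel)
    then show "z \<in> \<mu> ` {1..I}" using i by blast
  qed
  then have "\<forall>a. \<exists>i\<in>{1..I}. d a = \<mu> i" by blast
  then obtain c where c: "\<And>a. c a \<in> {1..I}" "\<And>a. d a = \<mu> (c a)" by metis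
  define E where "E i = V ** proj {a. c a = i} ** adj V" for i
  have "resolution I \<mu> E A"
    using resolution_conj[OF resolution_diag[OF c(1)] V, of \<mu>] unfolding E_def Ad
    by (simp add: c(2)[symmetric])
  then have QE: "Q i = E i" if "i \<in> {1..I}" for i by (rule resolution_unique[OF Q _ \<mu>(2) that])
  have "trace (E i) = of_nat (card {a. c a = i})" for i
    unfolding E_def by (subst trace_mult_commute)
      (simp add: matrix_mul_assoc unitary_matrix_mult[OF V] trace_proj)
  then have card: "card {a. c a = i} = k i" if "i \<in> {1..I}" for i
    using k(2)[OF that] QE[OF that] by (metis of_nat_eq_iff)
  have "{a. d a = \<mu> i} = {a. c a = i}" if "i \<in> {1..I}" for i
    using inj_onD[OF \<mu>(2)] c that by auto
  then have "multiplicity_eigenvalue A (\<mu> i) = k i" if "i \<in> {1..I}" for i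
    using card that by (simp add: Ad multiplicity_diagonalization[OF V])
  moreover have "\<mu> i \<in> range d" if "i \<in> {1..I}" for i
  proof -
    have "{a. c a = i} \<noteq> {}" using card[OF that] k(1)[OF that] by (metis card.empty less_irrefl)
    then show ?thesis using c(2) by auto
  qed
  then have "{z. eigenvalue A z} = \<mu> ` {1..I}" using ev \<open>range d \<subseteq> \<mu> ` {1..I}\<close> by blast
  ultimately show ?thesis unfolding unitary_with_multiplicities_def using A \<mu>(2) by blast
qed

lemma resolution_partial_sums:
  assumes "resolution I \<mu> E A" "j \<le> I"
  shows "adj (\<Sum>k=1..j. E k) = (\<Sum>k=1..j. E k)"
    "i \<le> j \<Longrightarrow> (\<Sum>k=1..j. E k) ** (\<Sum>k=1..i. E k) = (\<Sum>k=1..i. E k)"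
proof -
  note R = resolutionD[OF assms(1)]
  show "adj (\<Sum>k=1..j. E k) = (\<Sum>k=1..j. E k)"
    unfolding adj_sum using assms(2) by (intro sum.cong refl R(1)) auto
  assume i: "i \<le> j"
  have "(\<Sum>k=1..j. E k) ** E m = E m" if m: "m \<in> {1..i}" for m
  proof -
    have "(\<Sum>k=1..j. E k) ** E m = (\<Sum>k=1..j. if k = m then E m else 0)"
      unfolding mm.sum_left using m i assms(2) R(2,3) by (intro sum.cong) auto
    then show ?thesis using m i by simp
  qed
  then show "(\<Sum>k=1..j. E k) ** (\<Sum>k=1..i. E k) = (\<Sum>k=1..i. E k)"
    unfolding mm.sum_right by (rule sum.cong[OF refl])
qed

lemma diagonalization_imp_unitary_with_multiplicities:
  fixes V :: "complex^'n^'n"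
  assumes V: "unitary_matrix V" and c: "\<And>a. c a \<in> {1..I}"
    and k: "\<And>i. i \<in> {1..I} \<Longrightarrow> card {a. c a = i} = k i" "\<And>i. i \<in> {1..I} \<Longrightarrow> k i > 0"
    and l: "inj_on l {1..I}" "\<And>i. i \<in> {1..I} \<Longrightarrow> cmod (l i) = 1"
  shows "V ** diag (\<lambda>a. l (c a)) ** adj V \<in> unitary_with_multiplicities I k"
proof (rule resolution_imp_unitary_with_multiplicities[OF resolution_conj[OF resolution_diag[OF c] V] l(2,1) k(2)])
  fix i assume i: "i \<in> {1..I}"
  show "trace (V ** proj {a. c a = i} ** adj V) = of_nat (k i)"
    by (subst trace_mult_commute) (simp add: matrix_mul_assoc unitary_matrix_mult[OF V] trace_proj k(1)[OF i])
qed auto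

lemma unitary_with_multiplicities_conj:
  fixes V :: "complex^'n^'n"
  assumes k: "\<And>i. i \<in> {1..I} \<Longrightarrow> k i > 0" and V: "unitary_matrix V"
    and A: "A \<in> unitary_with_multiplicities I k"
  shows "V ** A ** adj V \<in> unitary_with_multiplicities I k"
proof -
  obtain W and c :: "'n \<Rightarrow> nat" and l where W: "unitary_matrix W" "\<And>a. c a \<in> {1..I}"
    "\<And>i. i \<in> {1..I} \<Longrightarrow> card {a. c a = i} = k i" "inj_on l {1..I}"
    "\<And>i. i \<in> {1..I} \<Longrightarrow> cmod (l i) = 1" "A = W ** diag (\<lambda>a. l (c a)) ** adj W"
    using unitary_with_multiplicities_diagonalization[OF A] by blast
  have "V ** A ** adj V = (V ** W) ** diag (\<lambda>a. l (c a)) ** adj (V ** W)"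
    by (simp add: W(6) adj_mult mm_assoc)
  then show ?thesis
    using diagonalization_imp_unitary_with_multiplicities[OF unitary_matrix_times[OF V W(1)] W(2,3) k W(4,5)] by simp
qed

section \<open>Coordinates for flags\<close>

text \<open>Both matrices are the orthogonal projection onto the range of \<open>B\<close>: each
  fixes the columns of the other, and taking adjoints exchanges the two factors.\<close>

lemma hermitian_projection_unique:
  fixes R S B :: "complex^'n^'n"
  assumes "adj R = R" "adj S = S" "R ** B = B" "S ** B = B" "R = B ** C" "S = B ** D"
  shows "R = S"
proof -
  have "S ** R = R" using assms(4,5) by (metis matrix_mul_assoc)
  moreover have "R ** S = S" using assms(3,6) by (metis matrix_mul_assoc)
  ultimately show ?thesis using assms(1,2) by (metis adj_mult)
qed

text \<open>For nearby projections \<open>R\<close> and \<open>P\<close>, the matrix \<open>G\<close> is the projection onto the range of \<open>R\<close>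
  along the kernel of \<open>P\<close>. The proofs rest on the fact that \<open>Z\<close> commutes with both
  projections.\<close>

lemma oblique_projection:
  fixes R P :: "complex^'n^'n"
  assumes R: "R ** R = R" and P: "P ** P = P"
    and Z: "Z = mat 1 - (R - P) ** (R - P)" "invertible Z" and G: "G = R ** P ** matrix_inv Z"
  shows "G ** P = G" "P ** G = P" "R ** G = G" "G ** R = R"
proof -
  have [simp]: "R ** (R ** X) = R ** X" "P ** (P ** X) = P ** X" for X
    using R P by (metis matrix_mul_assoc)+
  have PZ: "P ** Z = P ** R ** P" "Z ** P = P ** R ** P"
    and RZ: "R ** Z = R ** P ** R" "Z ** R = R ** P ** R"
    by (simp_all add: Z mm_distribs mm_assoc R P)
  have Pi: "P ** matrix_inv Z = matrix_inv Z ** P" by (rule commute_matrix_inv[OF Z(2)]) (simp add: PZ)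
  have Ri: "R ** matrix_inv Z = matrix_inv Z ** R" by (rule commute_matrix_inv[OF Z(2)]) (simp add: RZ)
  show "G ** P = G" by (simp add: G mm_assoc flip: Pi)
  show "R ** G = G" by (simp add: G mm_assoc)
  have "P ** G = (P ** R ** P) ** matrix_inv Z" by (simp add: G mm_assoc)
  also have "\<dots> = P" unfolding PZ(1)[symmetric] by (simp add: mm_assoc matrix_inv_mult Z(2))
  finally show "P ** G = P" .
  have "G ** R = (R ** P ** R) ** matrix_inv Z" by (simp add: G mm_assoc Ri)
  also have "\<dots> = R" unfolding RZ(1)[symmetric] by (simp add: mm_assoc matrix_inv_mult Z(2))
  finally show "G ** R = R" .
qed

lemma invertible_one_minus_square:
  fixes D :: "complex^'n^'n"
  assumes K: "\<And>(A :: complex^'n^'n) (B :: complex^'n^'n). norm (A ** B) \<le> norm A * norm B * K" "K > 0"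
    and D: "norm D * K < 1"
  shows "invertible (mat 1 - D ** D)"
proof (rule invertible_if_left_cancel)
  have contr: "norm (D ** X) \<le> norm D * K * norm X" for X :: "complex^'n^'n"
    using K(1)[of D X] by (simp add: mult_ac)
  fix Y :: "complex^'n^'n"
  assume "(mat 1 - D ** D) ** Y = 0"
  then have "Y = D ** (D ** Y)" by (simp add: mm_distribs mm_assoc)
  then have "norm Y \<le> norm D * K * norm (D ** Y)" using contr by metis
  also have "\<dots> \<le> norm (D ** Y)" using D K(2) by (intro mult_left_le_one_le) auto
  also have "\<dots> \<le> norm D * K * norm Y" by (rule contr)
  finally have "(1 - norm D * K) * norm Y \<le> 0" by (simp add: algebra_simps)
  then show "Y = 0" using D by (simp add: mult_le_0_iff)
qed

text \<open>The index type carries no order, so the blocks are the colour classes of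
  \<open>c\<close>, and \<open>c b < c a\<close> says that position \<open>(a, b)\<close> lies below
  the diagonal blocks.\<close>

locale flag_coordinates =
  fixes I :: nat and c :: "'n::finite \<Rightarrow> nat"
  assumes colour: "\<And>a. c a \<in> {1..I}" and colour_surj: "\<And>i. i \<in> {1..I} \<Longrightarrow> \<exists>a. c a = i"
begin

definition upto_proj :: "nat \<Rightarrow> complex^'n^'n" where "upto_proj j = proj {a. c a \<le> j}"
definition block_proj :: "nat \<Rightarrow> complex^'n^'n" where "block_proj j = proj {a. c a = j}"

lemma colour_bounds [simp]: "0 < c a" "Suc 0 \<le> c a" "c a \<le> I"
  using colour[of a] by auto

lemma upto_proj_idem [simp]: "upto_proj j ** upto_proj j = upto_proj j"
  and upto_proj_idem' [simp]: "upto_proj j ** (upto_proj j ** X) = upto_proj j ** X"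
  by (simp_all add: upto_proj_def proj_mult matrix_mul_assoc)

lemma adj_upto_proj [simp]: "adj (upto_proj j) = upto_proj j"
  by (simp add: upto_proj_def)

lemma upto_proj_0 [simp]: "upto_proj 0 = 0"
  by (auto simp: upto_proj_def vec_eq_iff proj_component)

lemma upto_proj_top [simp]: "upto_proj I = mat 1"
  by (auto simp: upto_proj_def vec_eq_iff proj_component mat_def)

lemma upto_proj_mult: "i \<le> j \<Longrightarrow> upto_proj j ** upto_proj i = upto_proj i"
  unfolding upto_proj_def proj_mult by (rule arg_cong[of _ _ proj]) auto

lemma upto_block_proj: "upto_proj j ** block_proj j = block_proj j"
  unfolding upto_proj_def block_proj_def proj_mult by (rule arg_cong[of _ _ proj]) auto

lemma block_upto_proj: "block_proj i ** upto_proj j = (if i \<le> j then block_proj i else 0)"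
  by (auto simp: upto_proj_def block_proj_def proj_mult vec_eq_iff proj_component)

lemma block_proj_mult: "block_proj i ** block_proj j = (if i = j then block_proj i else 0)"
  by (auto simp: block_proj_def proj_mult vec_eq_iff proj_component)

lemma block_proj_sum: "(\<Sum>j=1..I. block_proj j) = mat 1"
  using resolutionD(4)[OF resolution_diag[of c I, OF colour]] by (simp add: block_proj_def)

lemma block_proj_split: "(\<Sum>j=1..I. X ** block_proj j) = X" for X :: "complex^'n^'n"
  unfolding mm.sum_right[symmetric] block_proj_sum by simp

text \<open>The block lower unitriangular matrices. They form the unipotent group opposite to the
  stabiliser of the coordinate flag and parametrise the big cell around that flag.\<close>

definition unipotent :: "complex^'n^'n \<Rightarrow> bool" where
  "unipotent M \<longleftrightarrow> (\<forall>a b. c a \<le> c b \<longrightarrow> M $ a $ b = (if a = b then 1 else 0))"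

text \<open>Forward substitution by colour: once the rows of smaller colour vanish, row
  \<open>a\<close> of \<open>?H ** Y\<close> is row \<open>a\<close> of \<open>Y\<close>. The case
  \<open>j = I\<close> is the invertibility of \<open>M\<close> itself.\<close>

lemma unipotent_compression_invertible:
  assumes "unipotent M"
  shows "invertible (upto_proj j ** M ** upto_proj j + (mat 1 - upto_proj j))" (is "invertible ?H")
proof (rule invertible_if_left_cancel)
  fix Y :: "complex^'n^'n" assume Y: "?H ** Y = 0"
  have H: "?H $ a $ b = (if c a \<le> j \<and> c b \<le> j then M $ a $ b else if a = b then 1 else 0)" for a b
    by (auto simp: upto_proj_def proj_mult_component mult_proj_component proj_component mat_def)
  have "Y $ a $ b = 0" for a b
  proof (induction "c a" arbitrary: a rule: less_induct)
    case less
    have "?H $ a $ k * Y $ k $ b = (if k = a then Y $ a $ b else 0)" for k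
    proof (cases "c k < c a")
      case True
      then show ?thesis using less[of k] by auto
    next
      case False
      then show ?thesis unfolding H using assms unfolding unipotent_def by auto
    qed
    then have "(?H ** Y) $ a $ b = (\<Sum>k\<in>UNIV. if k = a then Y $ a $ b else 0)"
      by (simp add: matrix_matrix_mult_def[of ?H])
    then show ?case by (simp add: Y)
  qed
  then show "Y = 0" by (simp add: vec_eq_iff)
qed

lemma unipotent_invertible: "unipotent M \<Longrightarrow> invertible M"
  using unipotent_compression_invertible[of M I] by simp

definition gram :: "complex^'n^'n \<Rightarrow> nat \<Rightarrow> complex^'n^'n" where
  "gram M j = upto_proj j ** adj M ** M ** upto_proj j + (mat 1 - upto_proj j)"

text \<open>The orthogonal projection onto the range of \<open>B = M ** upto_proj j\<close>, in the form
  \<open>B (B\<^sup>* B)\<^sup>-\<^sup>1 B\<^sup>*\<close>; the summand in \<open>gram\<close> makes the inverse exist on the whole space.\<close>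

definition flag_proj :: "complex^'n^'n \<Rightarrow> nat \<Rightarrow> complex^'n^'n" where
  "flag_proj M j = M ** upto_proj j ** matrix_inv (gram M j) ** upto_proj j ** adj M"

text \<open>\<open>gram M j\<close> is positive definite: its quadratic form is the sum of the
  squared norms of \<open>M ** upto_proj j ** Y\<close> and
  \<open>(mat 1 - upto_proj j) ** Y\<close>, and \<open>M\<close> is injective.\<close>

lemma gram_invertible:
  assumes "unipotent M" shows "invertible (gram M j)"
proof (rule invertible_if_left_cancel)
  fix Y :: "complex^'n^'n" assume Y: "gram M j ** Y = 0"
  have "(M ** upto_proj j ** Y) \<bullet> (M ** upto_proj j ** Y)
      + ((mat 1 - upto_proj j) ** Y) \<bullet> ((mat 1 - upto_proj j) ** Y) = Y \<bullet> (gram M j ** Y)"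
    unfolding inner_mult_left[of "M ** upto_proj j"] inner_mult_left[of "mat 1 - upto_proj j"]
    by (simp add: gram_def adj_mult mm_assoc mm_distribs inner_add_right inner_diff_right)
  also have "\<dots> = 0" by (simp add: Y)
  finally have "M ** upto_proj j ** Y = 0" "(mat 1 - upto_proj j) ** Y = 0"
    by (metis add_nonneg_eq_0_iff inner_eq_zero_iff inner_ge_zero)+
  moreover from this have "matrix_inv M ** (M ** (upto_proj j ** Y)) = 0" by (simp add: mm_assoc)
  then have "upto_proj j ** Y = 0"
    by (simp add: matrix_mul_assoc matrix_inv_mult unipotent_invertible[OF assms])
  ultimately show "Y = 0" by (simp add: mm_distribs)
qed

context
  fixes M assumes M: "unipotent M"
begin

lemma gram_inv: "gram M j ** matrix_inv (gram M j) = mat 1" "matrix_inv (gram M j) ** gram M j = mat 1"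
  by (simp_all add: matrix_inv_mult gram_invertible[OF M])

lemma adj_flag_proj: "adj (flag_proj M j) = flag_proj M j"
proof -
  have "adj (gram M j) = gram M j" by (simp add: gram_def adj_mult mm_assoc)
  then show ?thesis by (simp add: flag_proj_def adj_mult mm_assoc adj_matrix_inv gram_invertible[OF M])
qed

lemma flag_proj_fixes: "flag_proj M j ** (M ** upto_proj j) = M ** upto_proj j"
proof -
  have "flag_proj M j ** (M ** upto_proj j)
      = M ** upto_proj j ** matrix_inv (gram M j) ** (upto_proj j ** adj M ** M ** upto_proj j)"
    by (simp add: flag_proj_def mm_assoc)
  also have "upto_proj j ** adj M ** M ** upto_proj j = gram M j ** upto_proj j"
    by (simp add: gram_def mm_distribs mm_assoc)
  also have "M ** upto_proj j ** matrix_inv (gram M j) ** (gram M j ** upto_proj j)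
      = M ** upto_proj j ** (matrix_inv (gram M j) ** gram M j) ** upto_proj j"
    by (simp only: mm_assoc)
  finally show ?thesis by (simp add: gram_inv mm_assoc)
qed

lemma flag_proj_range: "flag_proj M j = (M ** upto_proj j) ** (matrix_inv (gram M j) ** upto_proj j ** adj M)"
  by (simp add: flag_proj_def mm_assoc)

lemma flag_proj_mult:
  assumes "i \<le> j"
  shows "flag_proj M j ** flag_proj M i = flag_proj M i" "flag_proj M i ** flag_proj M j = flag_proj M i"
proof -
  have "flag_proj M j ** (M ** upto_proj i) = M ** upto_proj i"
    using flag_proj_fixes[of j] upto_proj_mult[OF assms] by (metis matrix_mul_assoc)
  then show "flag_proj M j ** flag_proj M i = flag_proj M i"
    by (subst (1 2) flag_proj_range[of i]) (metis matrix_mul_assoc)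
  from arg_cong[OF this, of adj] show "flag_proj M i ** flag_proj M j = flag_proj M i"
    by (simp add: adj_mult adj_flag_proj)
qed

lemma flag_proj_0: "flag_proj M 0 = 0"
  by (simp add: flag_proj_def)

lemma flag_proj_top: "flag_proj M I = mat 1"
proof -
  have "flag_proj M I ** M ** matrix_inv M = M ** matrix_inv M" using flag_proj_fixes[of I] by simp
  then show ?thesis by (simp add: mm_assoc matrix_inv_mult unipotent_invertible[OF M])
qed

text \<open>Cyclicity of the trace reduces the claim to \<open>matrix_inv (gram M j)\<close> times
  the compressed Gram matrix; this is \<open>upto_proj j\<close>, because \<open>gram M j\<close> is
  the identity on the complement.\<close>

lemma trace_flag_proj: "trace (flag_proj M j) = of_nat (card {a. c a \<le> j})"
proof -
  have "gram M j ** (mat 1 - upto_proj j) = mat 1 - upto_proj j"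
    by (simp add: gram_def mm_distribs mm_assoc)
  then have "matrix_inv (gram M j) ** (gram M j ** (mat 1 - upto_proj j))
    = matrix_inv (gram M j) ** (mat 1 - upto_proj j)" by simp
  then have e: "matrix_inv (gram M j) ** (mat 1 - upto_proj j) = mat 1 - upto_proj j"
    by (simp add: matrix_mul_assoc gram_inv)
  have "trace (flag_proj M j) = trace ((matrix_inv (gram M j) ** upto_proj j ** adj M) ** (M ** upto_proj j))"
    unfolding flag_proj_range by (rule trace_mult_commute)
  also have "\<dots> = trace (matrix_inv (gram M j) ** (gram M j - (mat 1 - upto_proj j)))"
    by (simp add: gram_def mm_assoc)
  also have "matrix_inv (gram M j) ** (gram M j - (mat 1 - upto_proj j)) = upto_proj j"
    by (simp add: mm.diff_right[of _ "gram M j"] e gram_inv)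
  also have "trace \<dots> = of_nat (card {a. c a \<le> j})" by (simp add: upto_proj_def trace_proj)
  finally show ?thesis .
qed

end

text \<open>Meaningful for \<open>i > 0\<close> only.\<close>

definition flag_step :: "complex^'n^'n \<Rightarrow> nat \<Rightarrow> complex^'n^'n" where
  "flag_step M i = flag_proj M i - flag_proj M (i - 1)"

lemma sum_flag_step: "unipotent M \<Longrightarrow> (\<Sum>i=1..j. flag_step M i) = flag_proj M j"
  by (induction j) (simp_all add: flag_step_def flag_proj_0)

lemma flag_step_resolution:
  assumes "unipotent M"
  shows "resolution I \<mu> (flag_step M) (\<Sum>i=1..I. mat (\<mu> i) ** flag_step M i)"
proof -
  have "flag_step M i ** flag_step M j = (if i = j then flag_step M i else 0)"
    if "i \<in> {1..I}" "j \<in> {1..I}" for i j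
  proof -
    \<comment> \<open>Each strict case lists the four index comparisons needed to multiply out two
      differences of nested projections.\<close>
    consider "i = j" | "i \<le> j - 1" "i - 1 \<le> j - 1" "i \<le> j" "i - 1 \<le> j" "i \<noteq> j"
      | "j \<le> i - 1" "j - 1 \<le> i - 1" "j \<le> i" "j - 1 \<le> i" "i \<noteq> j"
      by linarith
    then show ?thesis
      by cases (simp_all add: flag_step_def mm_distribs flag_proj_mult[OF assms])
  qed
  then show ?thesis
    using sum_flag_step[OF assms, of I] flag_proj_top[OF assms]
    by (auto simp: resolution_def flag_step_def adj_flag_proj[OF assms])
qed

lemma trace_flag_step:
  assumes "unipotent M" "i \<in> {1..I}"
  shows "trace (flag_step M i) = of_nat (card {a. c a = i})"
proof -
  have "{a. c a \<le> i} = {a. c a = i} \<union> {a. c a \<le> i - 1}" using assms(2) by auto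
  moreover have "{a. c a = i} \<inter> {a. c a \<le> i - 1} = {}"
  proof (rule equals0I)
    fix a assume "a \<in> {a. c a = i} \<inter> {a. c a \<le> i - 1}"
    then have "c a = i" "c a \<le> i - 1" by simp_all
    moreover have "i \<ge> 1" using assms(2) by simp
    ultimately show False by linarith
  qed
  ultimately have "card {a. c a \<le> i} = card {a. c a = i} + card {a. c a \<le> i - 1}"
    by (simp add: card_Un_disjoint)
  then show ?thesis
    by (simp add: flag_step_def trace_sub trace_flag_proj[OF assms(1)])
qed

text \<open>For an orthogonal projection \<open>R\<close>, invertibility of this matrix says that
  \<open>R - upto_proj j\<close> has operator norm below 1. In this form it can be used directly
  with \<open>matrix_inv\<close>.\<close>

definition closeness :: "complex^'n^'n \<Rightarrow> nat \<Rightarrow> complex^'n^'n" where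
  "closeness R j = mat 1 - (R - upto_proj j) ** (R - upto_proj j)"

definition oblique :: "complex^'n^'n \<Rightarrow> nat \<Rightarrow> complex^'n^'n" where
  "oblique R j = R ** upto_proj j ** matrix_inv (closeness R j)"

text \<open>Recovers \<open>M\<close> from the projections \<open>flag_proj M j\<close>.\<close>

definition flag_matrix :: "(nat \<Rightarrow> complex^'n^'n) \<Rightarrow> complex^'n^'n" where
  "flag_matrix R = (\<Sum>j=1..I. oblique (R j) j ** block_proj j)"

lemma flag_matrix_block: "j \<in> {1..I} \<Longrightarrow> flag_matrix R ** block_proj j = oblique (R j) j ** block_proj j"
  by (simp add: flag_matrix_def mm.sum_left mm_assoc block_proj_mult if_distrib[of "\<lambda>x. _ ** x"] cong: if_cong)

lemma oblique_props:
  assumes "R ** R = R" "invertible (closeness R j)"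
  shows "oblique R j ** upto_proj j = oblique R j" "upto_proj j ** oblique R j = upto_proj j"
    "R ** oblique R j = oblique R j" "oblique R j ** R = R"
  using oblique_projection[OF assms(1) _ closeness_def assms(2) oblique_def] by simp_all

text \<open>The identity \<open>upto_proj j ** oblique R j = upto_proj j\<close> says that the
  columns of block \<open>j\<close> agree with those of the unit matrix in all rows of colour at
  most \<open>j\<close>.\<close>

lemma flag_matrix_unipotent:
  assumes "\<And>j. j \<in> {1..I} \<Longrightarrow> R j ** R j = R j" "\<And>j. j \<in> {1..I} \<Longrightarrow> invertible (closeness (R j) j)"
  shows "unipotent (flag_matrix R)"
  unfolding unipotent_def
proof (intro allI impI)
  fix a b assume ab: "c a \<le> c b"
  define j where "j = c b"
  have j: "j \<in> {1..I}" using colour by (simp add: j_def)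
  have "upto_proj j ** flag_matrix R ** block_proj j = block_proj j"
    using flag_matrix_block[OF j, of R] oblique_props(2)[OF assms(1)[OF j] assms(2)[OF j]] upto_block_proj
    by (metis matrix_mul_assoc)
  then have "(upto_proj j ** flag_matrix R ** block_proj j) $ a $ b = block_proj j $ a $ b" by simp
  then show "flag_matrix R $ a $ b = (if a = b then 1 else 0)"
    using ab by (auto simp: upto_proj_def block_proj_def proj_mult_component mult_proj_component
        proj_component j_def split: if_splits)
qed

text \<open>The columns of block \<open>i\<close> lie in the range of \<open>R i\<close>, which for
  \<open>i \<le> j\<close> lies in that of \<open>R j\<close>; so \<open>R j\<close> fixes
  \<open>M ** upto_proj j\<close>. Conversely, invertibility of the compression \<open>H\<close>
  expresses \<open>R j\<close> through these columns, and the two orthogonal projections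
  agree.\<close>

lemma flag_proj_flag_matrix:
  assumes R: "\<And>j. j \<in> {1..I} \<Longrightarrow> adj (R j) = R j"
    "\<And>i j. i \<in> {1..I} \<Longrightarrow> j \<in> {1..I} \<Longrightarrow> i \<le> j \<Longrightarrow> R j ** R i = R i"
    and cl: "\<And>j. j \<in> {1..I} \<Longrightarrow> invertible (closeness (R j) j)" and j: "j \<in> {1..I}"
  shows "flag_proj (flag_matrix R) j = R j"
proof -
  define M where "M = flag_matrix R"
  have M: "unipotent M" unfolding M_def using R(2) cl by (intro flag_matrix_unipotent) auto
  note ob = oblique_props[OF R(2) cl]
  have Mj: "M ** upto_proj j = (\<Sum>i=1..I. if i \<le> j then oblique (R i) i ** block_proj i else 0)"
    unfolding M_def flag_matrix_def
    by (auto simp: mm.sum_left mm_assoc block_upto_proj intro!: sum.cong)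
  have fixes_: "R j ** (M ** upto_proj j) = M ** upto_proj j"
    unfolding Mj mm.sum_right
  proof (intro sum.cong refl)
    fix i assume i: "i \<in> {1..I}"
    have "R j ** oblique (R i) i = oblique (R i) i" if "i \<le> j"
      using ob(3)[OF i i _ i] R(2)[OF i j that] by (metis matrix_mul_assoc order_refl)
    then show "R j ** (if i \<le> j then oblique (R i) i ** block_proj i else 0)
      = (if i \<le> j then oblique (R i) i ** block_proj i else 0)"
      by (simp add: matrix_mul_assoc)
  qed
  define G where "G = oblique (R j) j"
  define H where "H = upto_proj j ** M ** upto_proj j + (mat 1 - upto_proj j)"
  have H: "invertible H" unfolding H_def by (rule unipotent_compression_invertible[OF M])
  have G: "G ** upto_proj j = G" "G ** R j = R j" using ob[OF j j _ j] by (simp_all add: G_def)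
  \<comment> \<open>\<open>G\<close> factors through \<open>upto_proj j\<close>, which removes the
    complementary summand of \<open>H\<close>, and is the identity on the range of
    \<open>R j\<close>, which contains the columns of \<open>M ** upto_proj j\<close>.\<close>
  have "G ** H = G ** upto_proj j ** (M ** upto_proj j)"
    by (simp add: H_def mm_distribs mm_assoc G(1)) (simp add: matrix_mul_assoc G(1))
  also have "\<dots> = G ** R j ** (M ** upto_proj j)"
    unfolding G(1) by (metis fixes_ matrix_mul_assoc)
  also have "\<dots> = M ** upto_proj j" unfolding G(2) by (rule fixes_)
  finally have GH: "G ** H = M ** upto_proj j" .
  have "R j = G ** (H ** matrix_inv H) ** R j" by (simp add: G(2) matrix_inv_mult H)
  also have "\<dots> = (M ** upto_proj j) ** (matrix_inv H ** R j)" by (simp add: mm_assoc flip: GH)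
  finally have "R j = (M ** upto_proj j) ** (matrix_inv H ** R j)" .
  from hermitian_projection_unique[OF adj_flag_proj[OF M] R(1)[OF j] flag_proj_fixes[OF M] fixes_
      flag_proj_range[OF M] this]
  show ?thesis by (simp add: M_def)
qed

text \<open>Applied to block \<open>j\<close> of \<open>M\<close>, the oblique projection
  \<open>G\<close> does nothing, as these columns lie in the range of the flag projection. But
  \<open>G = G ** upto_proj j\<close> sees only
  \<open>upto_proj j ** M ** block_proj j = block_proj j\<close>.\<close>

lemma flag_matrix_flag_proj:
  assumes M: "unipotent M" and cl: "\<And>j. j \<in> {1..I} \<Longrightarrow> invertible (closeness (flag_proj M j) j)"
  shows "flag_matrix (flag_proj M) = M"
proof -
  have "oblique (flag_proj M j) j ** block_proj j = M ** block_proj j" if j: "j \<in> {1..I}" for j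
  proof -
    define G where "G = oblique (flag_proj M j) j"
    have G: "G ** upto_proj j = G" "G ** flag_proj M j = flag_proj M j"
      using oblique_props[OF _ cl[OF j]] flag_proj_mult[OF M, of j j] by (simp_all add: G_def)
    have "upto_proj j ** M ** block_proj j = block_proj j"
      using M colour by (auto simp: unipotent_def upto_proj_def block_proj_def proj_mult_component mult_proj_component
        proj_component vec_eq_iff)
    then have 1: "G ** (M ** block_proj j) = G ** block_proj j"
      by (metis G(1) matrix_mul_assoc)
    have "flag_proj M j ** (M ** block_proj j) = M ** block_proj j"
      using flag_proj_fixes[OF M, of j] upto_block_proj[of j] by (metis matrix_mul_assoc)
    then have "G ** (M ** block_proj j) = M ** block_proj j" by (metis G(2) matrix_mul_assoc)
    with 1 show ?thesis by (simp add: G_def)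
  qed
  then have "flag_matrix (flag_proj M) = (\<Sum>j=1..I. M ** block_proj j)"
    unfolding flag_matrix_def by (rule sum.cong[OF refl])
  then show ?thesis by (simp only: block_proj_split)
qed

end

section \<open>The chart at a diagonal matrix\<close>

lemma continuous_on_matrix_inv:
  fixes F :: "'a::topological_space \<Rightarrow> complex^'n^'n"
  assumes "continuous_on S F" "\<And>x. x \<in> S \<Longrightarrow> invertible (F x)"
  shows "continuous_on S (\<lambda>x. matrix_inv (F x))"
  unfolding continuous_on_def
proof
  fix x assume x: "x \<in> S"
  have "\<forall>\<^sub>F y in at x within S. y \<in> S" by (simp add: eventually_at_filter)
  then have "\<forall>\<^sub>F y in at x within S. matrix_inv (F y) - matrix_inv (F x)
      = - (matrix_inv (F y) ** (F y - F x) ** matrix_inv (F x))"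
    by eventually_elim (rule matrix_inv_diff[OF assms(2)[OF x] assms(2)])
  moreover have "(F \<longlongrightarrow> F x) (at x within S)" using assms(1) x by (simp add: continuous_on_def)
  ultimately show "((\<lambda>x. matrix_inv (F x)) \<longlongrightarrow> matrix_inv (F x)) (at x within S)"
    by (rule tendsto_bilinear_inverse[OF bounded_bilinear_matrix_mult, rotated])
qed

lemma bounded_linear_trace: "bounded_linear (trace :: complex^'n^'n \<Rightarrow> complex)"
  by (intro linear_conv_bounded_linear[THEN iffD1] linearI)
    (simp_all add: trace_def sum.distrib scaleR_sum_right)

lemma trace_projection_nonzero:
  assumes "adj Q = Q" "Q ** Q = (Q :: complex^'n^'n)" "Q \<noteq> 0"
  shows "trace Q \<noteq> 0"
proof
  assume "trace Q = 0"
  then have "Q \<bullet> Q = 0" using assms(1,2) by (simp add: inner_matrix)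
  with assms(3) show False by simp
qed

lemma has_vector_derivative_along_line:
  assumes "(F has_derivative F') (at X)"
  shows "((\<lambda>s. F (X + s *\<^sub>R v)) has_vector_derivative F' v) (at (0::real))"
proof -
  have "((\<lambda>s. X + s *\<^sub>R v) has_derivative (\<lambda>s. s *\<^sub>R v)) (at (0::real))"
    by (auto intro!: derivative_eq_intros)
  then have "((\<lambda>s. F (X + s *\<^sub>R v)) has_derivative (\<lambda>s. F' (s *\<^sub>R v))) (at 0)"
    by (rule has_derivative_compose) (simp add: assms)
  then show ?thesis
    using has_derivative_linear[OF assms] by (simp add: has_vector_derivative_def linear_scale)
qed

text \<open>Eigenvalues within \<open>\<epsilon>\<close> of different \<open>l i\<close> stay
  \<open>\<epsilon>\<close> apart because of the factor 3. The bound
  \<open>\<epsilon> \<le> 1\<close> keeps the ratio of an eigenvalue to its \<open>l i\<close> in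
  the right half plane, away from the branch cut of \<open>Ln\<close>.\<close>

locale flag_chart = flag_coordinates I c for I :: nat and c :: "'n::finite \<Rightarrow> nat" +
  fixes l :: "nat \<Rightarrow> complex" and \<epsilon> :: real
  assumes l_norm: "\<And>i. i \<in> {1..I} \<Longrightarrow> cmod (l i) = 1"
    and eps: "\<epsilon> > 0" "\<epsilon> \<le> 1"
    and l_sep: "\<And>i j. i \<in> {1..I} \<Longrightarrow> j \<in> {1..I} \<Longrightarrow> i \<noteq> j \<Longrightarrow> 3 * \<epsilon> \<le> cmod (l i - l j)"
begin

definition base :: "complex^'n^'n" where "base = diag (\<lambda>a. l (c a))"

lemma base_resolution: "resolution I l block_proj base"
  using resolution_diag[of c I l, OF colour] by (simp add: base_def block_proj_def[abs_def])

lemma eigenvalues_apart: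
  assumes "i \<in> {1..I}" "j \<in> {1..I}" "i \<noteq> j" "cmod (x - l i) < \<epsilon>" "cmod (y - l j) < \<epsilon>"
  shows "\<epsilon> \<le> cmod (x - y)"
proof -
  have "cmod (l i - l j) \<le> cmod (x - l i) + cmod (x - y) + cmod (y - l j)"
    using norm_triangle_ineq[of "l i - x" "x - y"] norm_triangle_ineq[of "l i - x + (x - y)" "y - l j"]
    by (simp add: norm_minus_commute)
  with assms l_sep[OF assms(1-3)] show ?thesis by linarith
qed

lemma near_eigenvalues_inj:
  assumes "\<And>i. i \<in> {1..I} \<Longrightarrow> cmod (\<mu> i - l i) < \<epsilon>" shows "inj_on \<mu> {1..I}"
proof (rule inj_onI, rule ccontr)
  fix i j assume ij: "i \<in> {1..I}" "j \<in> {1..I}" "\<mu> i = \<mu> j" "i \<noteq> j"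
  then have "\<epsilon> \<le> cmod (\<mu> i - \<mu> j)" by (intro eigenvalues_apart[of i j] assms)
  with ij eps show False by simp
qed

text \<open>A resolution labelled compatibly with the base point. Nonzero \<open>E i\<close> makes
  the eigenvalues determined by \<open>A\<close>, and the closeness condition makes the flag matrix
  of the partial sums usable.\<close>

definition good :: "complex^'n^'n \<Rightarrow> (nat \<Rightarrow> complex) \<Rightarrow> (nat \<Rightarrow> complex^'n^'n) \<Rightarrow> bool" where
  "good A \<mu> E \<longleftrightarrow> resolution I \<mu> E A \<and>
     (\<forall>i\<in>{1..I}. cmod (\<mu> i) = 1 \<and> cmod (\<mu> i - l i) < \<epsilon> \<and> E i \<noteq> 0 \<and>
       invertible (closeness (\<Sum>j=1..i. E j) i))"

lemma good_close:
  assumes "good A \<mu> E" "good B \<nu> F" "i \<in> {1..I}"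
  shows "norm (E i - F i) \<le> 2 * real I / \<epsilon> * norm (A - B)"
  using assms eps eigenvalues_apart unfolding good_def by (intro resolution_close[of I \<mu> E A \<nu> F B]) auto

text \<open>The Lipschitz bound with \<open>A = B\<close> identifies the projections; as they are
  nonzero, the eigenvalues follow.\<close>

lemma good_unique:
  assumes "good A \<mu> E" "good A \<nu> F" "i \<in> {1..I}"
  shows "E i = F i" "\<mu> i = \<nu> i"
proof -
  show EF: "E i = F i" using good_close[OF assms] by simp
  have "mat (\<mu> i) ** E i = mat (\<nu> i) ** E i"
    using resolution_eigen(1)[of I \<mu> E A i] resolution_eigen(1)[of I \<nu> F A i] assms EF
    unfolding good_def by metis
  then have "mat (\<mu> i - \<nu> i) ** E i = 0" by (simp add: mat_diff mm_distribs)
  then show "\<mu> i = \<nu> i" using assms by (auto simp: mat_eq_0_iff good_def)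
qed

lemma norm_block_proj_ge_1: "j \<in> {1..I} \<Longrightarrow> 1 \<le> norm (block_proj j)"
proof -
  assume "j \<in> {1..I}"
  then obtain a where a: "c a = j" using colour_surj by blast
  have "1 = norm (block_proj j $ a $ a)" using a by (simp add: block_proj_def proj_component)
  also have "\<dots> \<le> norm (block_proj j $ a)" by (rule Finite_Cartesian_Product.norm_nth_le)
  also have "\<dots> \<le> norm (block_proj j)" by (rule Finite_Cartesian_Product.norm_nth_le)
  finally show ?thesis .
qed

lemma upto_proj_sum: "(\<Sum>i=1..j. block_proj i) = upto_proj j"
proof -
  have "(\<Sum>i=1..j. block_proj i $ a $ b) = upto_proj j $ a $ b" for a b
  proof -
    have "(\<Sum>i=1..j. block_proj i $ a $ b) = (\<Sum>i=1..j. if i = c a then (if a = b then 1 else 0) else 0)"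
      by (intro sum.cong) (auto simp: block_proj_def proj_component)
    then show ?thesis by (simp add: upto_proj_def proj_component)
  qed
  then show ?thesis by (simp add: vec_eq_iff)
qed

lemma good_exists:
  obtains \<delta> where "\<delta> > 0" "\<And>A \<mu> E. resolution I \<mu> E A \<Longrightarrow> (\<And>i. i \<in> {1..I} \<Longrightarrow> cmod (\<mu> i) = 1) \<Longrightarrow>
    norm (A - base) < \<delta> \<Longrightarrow> \<exists>\<mu> E. good A \<mu> E"
proof -
  obtain K where K: "K > 0" "\<And>(A :: complex^'n^'n) (B :: complex^'n^'n). norm (A ** B) \<le> norm A * norm B * K"
    using mm.pos_bounded by blast
  have I: "I \<ge> 1" using order_trans[OF colour_bounds(2,3)] by simp
  \<comment> \<open>Chosen so that \<open>\<eta> * (2 * I * (K + 1)) < 1\<close> for the projection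
    error \<open>\<eta>\<close> below. This gives both \<open>\<eta> < 1\<close>, hence
    \<open>F i \<noteq> 0\<close>, and \<open>I * \<eta> * K < 1\<close>, hence invertible closeness
    of the partial sums.\<close>
  define \<delta> where "\<delta> = \<epsilon> / (4 * real I * real I * (K + 1))"
  have "\<delta> > 0" using eps I K by (simp add: \<delta>_def)
  moreover have "\<exists>\<mu> E. good A \<mu> E"
    if res: "resolution I \<mu> E A" and \<mu>1: "\<And>i. i \<in> {1..I} \<Longrightarrow> cmod (\<mu> i) = 1"
      and A: "norm (A - base) < \<delta>" for A \<mu> E
  proof -
    have small: "norm (A - base) * (4 * real I * real I * (K + 1)) < \<epsilon>"
      using A K(1) I unfolding \<delta>_def by (subst (asm) pos_less_divide_eq) auto
    have "1 * 1 \<le> (4 * real I) * (K + 1)" using I K(1) by (intro mult_mono) auto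
    then have "real I * 1 \<le> real I * ((4 * real I) * (K + 1))" by (intro mult_left_mono) auto
    then have I_le: "real I \<le> 4 * real I * real I * (K + 1)" by (simp only: mult_ac mult_1_right)
    have "norm (A - base) * I \<le> norm (A - base) * (4 * real I * real I * (K + 1))"
      by (rule mult_left_mono[OF I_le]) simp
    with small have near: "norm (A - base) * I < \<epsilon>" by linarith
    have "\<exists>i\<in>{1..I}. cmod (\<mu> i - l j) < \<epsilon>" if j: "j \<in> {1..I}" for j
    proof (rule resolution_eigenvalue_near[OF res base_resolution j eps(1)])
      have "\<epsilon> * 1 \<le> \<epsilon> * norm (block_proj j)"
        using norm_block_proj_ge_1[OF j] eps(1) by (intro mult_left_mono) auto
      with near show "norm (A - base) * I < \<epsilon> * norm (block_proj j)" by linarith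
    qed
    then obtain \<sigma> where \<sigma>: "\<And>j. j \<in> {1..I} \<Longrightarrow> \<sigma> j \<in> {1..I}" "\<And>j. j \<in> {1..I} \<Longrightarrow> cmod (\<mu> (\<sigma> j) - l j) < \<epsilon>"
      by metis
    define \<nu> where "\<nu> = \<mu> \<circ> \<sigma>"
    define F where "F = E \<circ> \<sigma>"
    \<comment> \<open>Eigenvalues picked near different \<open>l j\<close> are different, so
      \<open>\<sigma>\<close> is a permutation of the labels.\<close>
    have "inj_on \<nu> {1..I}" using \<sigma>(2) by (intro near_eigenvalues_inj) (auto simp: \<nu>_def)
    then have "inj_on \<sigma> {1..I}" unfolding \<nu>_def by (rule inj_on_imageI2)
    then have resF: "resolution I \<nu> F A"
      unfolding \<nu>_def F_def using \<sigma>(1) by (intro resolution_reindex[OF res]) auto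
    define \<eta> where "\<eta> = 2 * real I / \<epsilon> * norm (A - base)"
    have close: "norm (F i - block_proj i) \<le> \<eta>" if "i \<in> {1..I}" for i
      unfolding \<eta>_def using \<sigma>(2) eps
      by (intro resolution_close[OF resF base_resolution _ _ that] eigenvalues_apart) (auto simp: \<nu>_def)
    have "\<eta> * (2 * real I * (K + 1)) = norm (A - base) * (4 * real I * real I * (K + 1)) / \<epsilon>"
      by (simp add: \<eta>_def)
    then have \<eta>: "\<eta> * (2 * real I * (K + 1)) < 1" using small eps by simp
    have "\<eta> \<ge> 0" using eps by (simp add: \<eta>_def)
    have "1 * 1 \<le> (2 * real I) * (K + 1)" using I K(1) by (intro mult_mono) auto
    then have "\<eta> * 1 \<le> \<eta> * (2 * real I * (K + 1))"
      using \<open>\<eta> \<ge> 0\<close> by (intro mult_left_mono) auto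
    with \<eta> have \<eta>1: "\<eta> < 1" by linarith
    have "\<eta> * (I * K) \<le> \<eta> * (2 * real I * (K + 1))"
      using I K(1) \<open>\<eta> \<ge> 0\<close> by (intro mult_left_mono) (auto simp: algebra_simps)
    with \<eta> have \<eta>2: "I * \<eta> * K < 1" by (simp add: mult_ac)
    have "F i \<noteq> 0" if "i \<in> {1..I}" for i
      using close[OF that] norm_block_proj_ge_1[OF that] \<eta>1 by auto
    moreover have "invertible (closeness (\<Sum>j=1..i. F j) i)" if i: "i \<in> {1..I}" for i
      unfolding closeness_def
    proof (rule invertible_one_minus_square[OF K(2,1)])
      have "norm ((\<Sum>j=1..i. F j) - upto_proj i) = norm (\<Sum>j=1..i. F j - block_proj j)"
        unfolding upto_proj_sum[symmetric] sum_subtractf ..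
      also have "\<dots> \<le> (\<Sum>j=1..i. \<eta>)" using i by (intro sum_norm_le close) auto
      also have "\<dots> \<le> I * \<eta>" using i \<open>\<eta> \<ge> 0\<close> by (auto intro: mult_right_mono)
      finally show "norm ((\<Sum>j=1..i. F j) - upto_proj i) * K < 1"
        using \<eta>2 K(1) by (meson mult_right_mono le_less_trans less_imp_le)
    qed
    ultimately have "good A \<nu> F"
      unfolding good_def using resF \<sigma> \<mu>1 by (auto simp: \<nu>_def)
    then show ?thesis by blast
  qed
  ultimately show ?thesis using that by blast
qed

section \<open>The chart and its space of coordinates\<close>

definition rep :: "nat \<Rightarrow> 'n" where "rep i = (SOME a. c a = i)"

lemma colour_rep: "i \<in> {1..I} \<Longrightarrow> c (rep i) = i"
  unfolding rep_def using colour_surj by (rule someI_ex)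

definition lower :: "complex^'n^'n \<Rightarrow> complex^'n^'n" where
  "lower X = (\<chi> a b. if c b < c a then X $ a $ b else 0)"

text \<open>The angle of eigenvalue \<open>i\<close> is kept in a diagonal entry, which
  \<open>lower\<close> ignores. One matrix of the ambient type thus holds all coordinates.\<close>

definition phase :: "complex^'n^'n \<Rightarrow> nat \<Rightarrow> real" where
  "phase X i = Re (X $ rep i $ rep i)"

definition eigval :: "complex^'n^'n \<Rightarrow> nat \<Rightarrow> complex" where
  "eigval X i = l i * exp (\<i> * phase X i)"

definition chart :: "complex^'n^'n \<Rightarrow> complex^'n^'n" where
  "chart X = (\<Sum>i=1..I. mat (eigval X i) ** flag_step (mat 1 + lower X) i)"

definition coords :: "complex^'n^'n \<Rightarrow> (nat \<Rightarrow> real) \<Rightarrow> complex^'n^'n" where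
  "coords M t = (\<chi> a b. if c b < c a then M $ a $ b
     else if a = b \<and> a = rep (c a) then complex_of_real (t (c a)) else 0)"

definition coord_basis :: "(complex^'n^'n) set" where
  "coord_basis = (\<lambda>(u, a, b). axis a (axis b u)) ` ({1, \<i>} \<times> {(a, b). c b < c a})
     \<union> (\<lambda>i. axis (rep i) (axis (rep i) 1)) ` {1..I}"

text \<open>Given as a coordinate subspace, so that its dimension is the number of standard basis
  vectors in \<open>coord_basis\<close>.\<close>

definition coord_space :: "(complex^'n^'n) set" where
  "coord_space = {X. \<forall>b\<in>Basis. b \<notin> coord_basis \<longrightarrow> X \<bullet> b = 0}"

lemma coord_basis_subset: "coord_basis \<subseteq> Basis"
  by (auto simp: coord_basis_def Basis_vec_def Basis_complex_def)

lemma subspace_coord_space: "subspace coord_space"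
  unfolding coord_space_def by (rule subspace_substandard)

lemma axis_axis_mem_coord_basis:
  "axis a (axis b u) \<in> coord_basis \<longleftrightarrow>
     (u = 1 \<or> u = \<i>) \<and> c b < c a \<or> u = 1 \<and> a = b \<and> a = rep (c a)" if "u \<noteq> 0" for u :: complex
proof -
  have "axis a (axis b u) = axis a' (axis b' u') \<longleftrightarrow> a = a' \<and> b = b' \<and> u = u'" if "u' \<noteq> 0" for a' b' u'
    using that \<open>u \<noteq> 0\<close> by (auto simp: axis_eq_axis axis_eq_0_iff)
  then show ?thesis
    using colour colour_rep unfolding coord_basis_def by (auto simp: image_iff)
qed

lemma coord_space_iff: "X \<in> coord_space \<longleftrightarrow> coords X (phase X) = X"
proof -
  have "X \<in> coord_space \<longleftrightarrow> (\<forall>a b. \<not> c b < c a \<longrightarrow>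
      Im (X $ a $ b) = 0 \<and> (\<not> (a = b \<and> a = rep (c a)) \<longrightarrow> Re (X $ a $ b) = 0))"
    unfolding coord_space_def Basis_vec_def Basis_complex_def
    by (auto simp: inner_axis axis_axis_mem_coord_basis inner_complex_def)
  also have "\<dots> \<longleftrightarrow> coords X (phase X) = X"
    by (auto simp: vec_eq_iff coords_def phase_def complex_eq_iff) 
  finally show ?thesis .
qed

lemma dim_coord_space: "dim coord_space = 2 * card {(a, b). c b < c a} + I"
proof -
  define P where "P = {(a, b). c b < c a}"
  have "inj_on (\<lambda>(u :: complex, a :: 'n, b :: 'n). axis a (axis b u)) ({1, \<i>} \<times> P)"
    by (auto simp: inj_on_def axis_eq_axis axis_eq_0_iff)
  then have 1: "card ((\<lambda>(u :: complex, a, b). axis a (axis b u)) ` ({1, \<i>} \<times> P)) = 2 * card P"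
    by (subst card_image) (auto simp: card_cartesian_product)
  have "inj_on (\<lambda>i. axis (rep i) (axis (rep i) (1::complex))) {1..I}"
    by (rule inj_onI) (metis axis_eq_axis colour_rep axis_eq_0_iff one_neq_zero)
  then have 2: "card ((\<lambda>i. axis (rep i) (axis (rep i) (1::complex))) ` {1..I}) = I"
    by (subst card_image) auto
  have "dim coord_space = card coord_basis"
    unfolding coord_space_def by (rule dim_substandard[OF coord_basis_subset])
  also have "\<dots> = 2 * card P + I"
  proof -
    have "(\<lambda>(u :: complex, a, b). axis a (axis b u)) ` ({1, \<i>} \<times> P)
        \<inter> (\<lambda>i. axis (rep i) (axis (rep i) 1)) ` {1..I} = {}"
      by (auto simp: axis_eq_axis axis_eq_0_iff P_def)
    then show ?thesis
      unfolding coord_basis_def P_def[symmetric] by (simp add: card_Un_disjoint 1 2[simplified])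
  qed
  finally show ?thesis by (simp add: P_def)
qed

lemma unipotent_lower [simp]: "unipotent (mat 1 + lower X)"
  by (auto simp: unipotent_def lower_def mat_def)

lemma lower_coords: "unipotent M \<Longrightarrow> mat 1 + lower (coords M t) = M"
  by (auto simp: unipotent_def lower_def coords_def mat_def vec_eq_iff)

lemma phase_coords: "i \<in> {1..I} \<Longrightarrow> phase (coords M t) i = t i"
  by (simp add: phase_def coords_def colour_rep)

lemma coords_mem: "coords M t \<in> coord_space"
proof -
  have phase: "phase (coords M t) (c a) = t (c a)" for a by (rule phase_coords[OF colour])
  have "coords (coords M t) (phase (coords M t)) $ a $ b = coords M t $ a $ b" for a b
    unfolding coords_def[of "coords M t"] by (simp add: phase) (auto simp: coords_def)
  then show ?thesis by (simp add: coord_space_iff vec_eq_iff)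
qed

lemma chart_resolution: "resolution I (eigval X) (flag_step (mat 1 + lower X)) (chart X)"
  unfolding chart_def by (rule flag_step_resolution) simp

lemma norm_eigval: "i \<in> {1..I} \<Longrightarrow> cmod (eigval X i) = 1"
  by (simp add: eigval_def norm_mult l_norm)

lemma chart_mem:
  assumes "\<And>i. i \<in> {1..I} \<Longrightarrow> cmod (eigval X i - l i) < \<epsilon>" "\<And>i. i \<in> {1..I} \<Longrightarrow> card {a. c a = i} = k i"
  shows "chart X \<in> unitary_with_multiplicities I k"
proof (rule resolution_imp_unitary_with_multiplicities[OF chart_resolution norm_eigval near_eigenvalues_inj[OF assms(1)]])
  fix i assume i: "i \<in> {1..I}"
  then have "{a. c a = i} \<noteq> {}" using colour_surj by blast
  then show "k i > 0" using assms(2)[OF i] by (metis card_gt_0_iff finite)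
  show "trace (flag_step (mat 1 + lower X) i) = of_nat (k i)"
    using trace_flag_step[OF unipotent_lower i] assms(2)[OF i] by simp
qed auto

lemma bounded_linear_lower: "bounded_linear lower"
  by (intro linear_conv_bounded_linear[THEN iffD1] linearI) (simp_all add: vec_eq_iff lower_def)

lemma bounded_linear_phase: "bounded_linear (\<lambda>X. \<i> * complex_of_real (phase X i))"
  by (intro linear_conv_bounded_linear[THEN iffD1] linearI)
    (simp_all add: phase_def algebra_simps scaleR_conv_of_real[where 'a=complex])

text \<open>\<open>mat 1 + lower X\<close> is unipotent for every \<open>X\<close>, so the Gram
  matrix is invertible everywhere and smoothness holds on the whole space.\<close>

lemma smooth_flag_proj: "C_infinity_on UNIV (\<lambda>X. flag_proj (mat 1 + lower X) j)"
proof -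
  have N: "C_infinity_on UNIV (\<lambda>X. mat 1 + lower X)"
    by (intro C_infinity_on_add C_infinity_on_const C_infinity_on_id
        C_infinity_on_bounded_linear[OF bounded_linear_lower]) auto
  have A: "C_infinity_on UNIV (\<lambda>X. adj (mat 1 + lower X))"
    by (rule C_infinity_on_bounded_linear[OF bounded_linear_adj _ N]) auto
  note mult = C_infinity_on_bounded_bilinear[OF bounded_bilinear_matrix_mult]
  have "C_infinity_on UNIV (\<lambda>X. gram (mat 1 + lower X) j)"
    unfolding gram_def by (intro C_infinity_on_add mult C_infinity_on_const N A) auto
  then have "C_infinity_on UNIV (\<lambda>X. matrix_inv (gram (mat 1 + lower X) j))"
    by (rule C_infinity_on_bilinear_inverse[OF bounded_bilinear_matrix_mult])
      (intro matrix_inv_diff gram_invertible unipotent_lower)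
  then show ?thesis
    unfolding flag_proj_def by (intro mult C_infinity_on_const N A) auto
qed

lemma smooth_flag_step: "C_infinity_on UNIV (\<lambda>X. flag_step (mat 1 + lower X) i)"
  unfolding flag_step_def by (intro C_infinity_on_diff smooth_flag_proj) auto

lemma smooth_eigval: "C_infinity_on UNIV (\<lambda>X. eigval X i)"
  unfolding eigval_def
  by (rule C_infinity_on_bounded_linear[OF bounded_linear_mult_right])
    (auto intro: C_infinity_on_exp_linear bounded_linear_phase)

lemma smooth_chart: "C_infinity_on UNIV chart"
  unfolding chart_def[abs_def]
  by (intro C_infinity_on_sum C_infinity_on_bounded_bilinear[OF bounded_bilinear_matrix_mult]
      C_infinity_on_bounded_linear[OF bounded_linear_mat] smooth_eigval smooth_flag_step) auto

text \<open>Along \<open>X + s v\<close> the chart is stationary to first order. Differentiating the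
  eigenvalue equation and multiplying by the projections shows that no eigenvalue moves and that
  \<open>q' i\<close> maps into the range of \<open>q i 0\<close>; idempotence and self-adjointness
  then force \<open>q' i = 0\<close>. With the flag stationary, the unitriangular matrix is
  stationary too.\<close>

lemma chart_derivative_injective:
  assumes X: "\<And>i. i \<in> {1..I} \<Longrightarrow> cmod (eigval X i - l i) < \<epsilon>"
    "\<And>i. i \<in> {1..I} \<Longrightarrow> invertible (closeness (flag_proj (mat 1 + lower X) i) i)"
    "\<And>i. i \<in> {1..I} \<Longrightarrow> flag_step (mat 1 + lower X) i \<noteq> 0"
    and v: "v \<in> coord_space" "frechet_derivative chart (at X) v = 0"
  shows "v = 0"
proof -
  define N where "N s = mat 1 + lower (X + s *\<^sub>R v)" for s :: real
  define q where "q i s = flag_step (N s) i" for i s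
  define q' where "q' i = frechet_derivative (\<lambda>X. flag_step (mat 1 + lower X) i) (at X) v" for i
  define m' where "m' i = \<i> * phase v i * eigval X i" for i
  have res: "resolution I (eigval (X + s *\<^sub>R v)) (\<lambda>i. q i s) (chart (X + s *\<^sub>R v))" for s
    using chart_resolution unfolding q_def N_def by auto
  note res0 = res[of 0, simplified]
  note R = resolutionD[OF res0]
  note mult = mm.has_vector_derivative
  have dq: "(q i has_vector_derivative q' i) (at 0)" for i
    unfolding q_def[abs_def] q'_def N_def
    by (rule has_vector_derivative_along_line)
      (use C_infinity_on_differentiable[OF smooth_flag_step] frechet_derivative_works in auto)
  have "(chart has_derivative frechet_derivative chart (at X)) (at X)"
    using C_infinity_on_differentiable[OF smooth_chart] frechet_derivative_works by auto
  from has_vector_derivative_along_line[OF this, of v]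
  have df: "((\<lambda>s. chart (X + s *\<^sub>R v)) has_vector_derivative 0) (at 0)" by (simp add: v(2))
  have "((\<lambda>X. eigval X i) has_derivative (\<lambda>v. l i * (\<i> * phase v i * exp (\<i> * phase X i)))) (at X)" for i
    unfolding eigval_def
    by (rule has_derivative_mult_right)
      (use has_derivative_compose[OF bounded_linear_imp_has_derivative[OF bounded_linear_phase[of i]]
        DERIV_exp[of "\<i> * phase X i", unfolded has_field_derivative_def]] in \<open>simp add: mult.commute\<close>)
  from has_vector_derivative_along_line[OF this, of v]
  have "((\<lambda>s. eigval (X + s *\<^sub>R v) i) has_vector_derivative m' i) (at 0)" for i
    by (simp add: m'_def eigval_def mult_ac)
  from bounded_linear.has_vector_derivative[OF bounded_linear_mat this]
  have dm: "((\<lambda>s. mat (eigval (X + s *\<^sub>R v) i) :: complex^'n^'n) has_vector_derivative mat (m' i)) (at 0)" for i .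
  \<comment> \<open>Both sides are derivatives of \<open>chart (X + s v) ** q i s\<close>, one by
    the product rule with zero derivative of the chart, one through the eigenvalue equation.\<close>
  have eig: "chart X ** q' i = mat (eigval X i) ** q' i + mat (m' i) ** q i 0" if i: "i \<in> {1..I}" for i
  proof -
    have "((\<lambda>s. chart (X + s *\<^sub>R v) ** q i s) has_vector_derivative chart X ** q' i) (at 0)"
      using mult[OF df dq[of i]] by simp
    moreover have "((\<lambda>s. chart (X + s *\<^sub>R v) ** q i s) has_vector_derivative
        mat (eigval X i) ** q' i + mat (m' i) ** q i 0) (at 0)"
      using mult[OF dm[of i] dq[of i]] by (simp add: resolution_eigen(1)[OF res i])
    ultimately show ?thesis by (rule vector_derivative_unique_at)
  qed
  have inj: "inj_on (eigval X) {1..I}" using X(1) by (rule near_eigenvalues_inj)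
  have qv: "phase v i = 0 \<and> q' i = 0" if i: "i \<in> {1..I}" for i
  proof -
    have "q i 0 ** (chart X ** q' i) = mat (eigval X i) ** (q i 0 ** q' i)"
      using resolution_eigen(2)[OF res0 i] by (simp add: matrix_mul_assoc)
    moreover have "q i 0 ** (chart X ** q' i) = mat (eigval X i) ** (q i 0 ** q' i) + mat (m' i) ** q i 0"
      using R(2)[OF i] by (simp add: eig[OF i] mm.add_right mat_mult_left_commute)
    ultimately have "mat (m' i) ** q i 0 = 0" by simp
    then have m': "m' i = 0" using X(3)[OF i] by (simp add: mat_eq_0_iff q_def N_def)
    moreover have "eigval X i \<noteq> 0" using norm_eigval[OF i, of X] by auto
    ultimately have ph: "phase v i = 0" by (simp add: m'_def)
    have "q j 0 ** q' i = 0" if j: "j \<in> {1..I}" "j \<noteq> i" for j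
    proof -
      have "q j 0 ** (chart X ** q' i) = mat (eigval X j) ** (q j 0 ** q' i)"
        using resolution_eigen(2)[OF res0 j(1)] by (simp add: matrix_mul_assoc)
      moreover have "q j 0 ** (chart X ** q' i) = mat (eigval X i) ** (q j 0 ** q' i)"
        by (simp add: eig[OF i] m' mat_mult_left_commute)
      ultimately have "mat (eigval X j - eigval X i) ** (q j 0 ** q' i) = 0"
        by (simp add: mat_diff mm_distribs)
      then show ?thesis using inj_onD[OF inj _ j(1) i] j(2) by (auto simp: mat_eq_0_iff)
    qed
    then have "q' i = q i 0 ** q' i"
      using resolution_split(1)[OF res0, of "q' i"] sum.remove[OF _ i, of "\<lambda>j. q j 0 ** q' i"] by simp
    \<comment> \<open>Together with \<open>q' i = q i 0 ** q' i\<close> this leaves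
      \<open>q' i ** q i 0 = 0\<close>, whose adjoint is \<open>q i 0 ** q' i = 0\<close>.\<close>
    moreover have "q' i = q i 0 ** q' i + q' i ** q i 0"
    proof -
      have "q i s ** q i s = q i s" for s using resolutionD(2)[OF res i] .
      then have "(q i has_vector_derivative q i 0 ** q' i + q' i ** q i 0) (at 0)"
        using mult[OF dq[of i] dq[of i]] by simp
      with dq show ?thesis by (rule vector_derivative_unique_at)
    qed
    ultimately have z: "q' i ** q i 0 = 0" by simp
    have "adj (q' i) = q' i"
    proof -
      have "adj (q i s) = q i s" for s using resolutionD(1)[OF res i] .
      then have "(q i has_vector_derivative adj (q' i)) (at 0)"
        using bounded_linear.has_vector_derivative[OF bounded_linear_adj dq[of i]] by simp
      then show ?thesis using dq by (rule vector_derivative_unique_at)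
    qed
    then have "q i 0 ** q' i = 0" using arg_cong[OF z, of adj] R(1)[OF i] by (simp add: adj_mult)
    with \<open>q' i = q i 0 ** q' i\<close> ph show ?thesis by simp
  qed
  have low: "lower v ** block_proj j = 0" if j: "j \<in> {1..I}" for j
  proof -
    have "((\<lambda>s. \<Sum>i=1..j. q i s) has_vector_derivative (\<Sum>i=1..j. q' i)) (at 0)"
      by (intro has_vector_derivative_sum dq)
    also have "(\<Sum>i=1..j. q' i) = 0" using qv j by (intro sum.neutral) auto
    also have "(\<lambda>s. \<Sum>i=1..j. q i s) = (\<lambda>s. flag_proj (N s) j)"
      unfolding q_def N_def by (intro ext sum_flag_step unipotent_lower)
    finally have dR: "((\<lambda>s. flag_proj (N s) j) has_vector_derivative 0) (at 0)" .
    have "N = (\<lambda>s. mat 1 + lower X + s *\<^sub>R lower v)"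
      by (simp add: fun_eq_iff N_def linear_add[OF bounded_linear.linear[OF bounded_linear_lower]]
          linear_scale[OF bounded_linear.linear[OF bounded_linear_lower]])
    moreover have "((\<lambda>s. mat 1 + lower X + s *\<^sub>R lower v) has_vector_derivative lower v) (at 0)"
      by (auto intro!: derivative_eq_intros)
    ultimately have "(N has_vector_derivative lower v) (at 0)" by (simp only:)
    from mult[OF this has_vector_derivative_const[of "block_proj j"]]
    have dN: "((\<lambda>s. N s ** block_proj j) has_vector_derivative lower v ** block_proj j) (at 0)" by simp
    have fixes_: "flag_proj (N s) j ** (N s ** block_proj j) = N s ** block_proj j" for s
    proof -
      have "flag_proj (N s) j ** (N s ** block_proj j) = flag_proj (N s) j ** (N s ** upto_proj j) ** block_proj j"
        by (simp add: mm_assoc upto_block_proj)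
      also have "flag_proj (N s) j ** (N s ** upto_proj j) = N s ** upto_proj j"
        unfolding N_def by (rule flag_proj_fixes) simp
      finally show ?thesis by (simp add: mm_assoc upto_block_proj)
    qed
    \<comment> \<open>Differentiating \<open>fixes_\<close> with a stationary projection puts
      \<open>lower v ** block_proj j\<close> into the range of that projection, where
      \<open>G\<close> acts as the identity. But its rows of colour at most \<open>j\<close> vanish,
      so \<open>G = G ** upto_proj j\<close> annihilates it.\<close>
    have "((\<lambda>s. N s ** block_proj j) has_vector_derivative flag_proj (N 0) j ** (lower v ** block_proj j)) (at 0)"
      using mult[OF dR dN] by (simp add: fixes_)
    then have e: "lower v ** block_proj j = flag_proj (N 0) j ** (lower v ** block_proj j)"
      using dN vector_derivative_unique_at by blast
    define G where "G = oblique (flag_proj (N 0) j) j"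
    have G: "G ** upto_proj j = G" "G ** flag_proj (N 0) j = flag_proj (N 0) j"
      using oblique_props[of "flag_proj (N 0) j" j] X(2)[OF j] flag_proj_mult[OF unipotent_lower, of j j X]
      by (simp_all add: G_def N_def)
    have "upto_proj j ** (lower v ** block_proj j) = 0"
      by (auto simp: vec_eq_iff matrix_mul_assoc upto_proj_def block_proj_def proj_mult_component mult_proj_component lower_def)
    then have "G ** (lower v ** block_proj j) = 0" by (metis G(1) matrix_mul_assoc times0_right)
    then show ?thesis by (metis e G(2) matrix_mul_assoc)
  qed
  have "lower v = (\<Sum>j=1..I. lower v ** block_proj j)" by (simp only: block_proj_split)
  also have "\<dots> = 0" using low by (intro sum.neutral) auto
  finally have "lower v = 0" .
  then have "v $ a $ b = 0" if "c b < c a" for a b using that by (auto simp: vec_eq_iff lower_def split: if_splits)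
  moreover have "phase v (c a) = 0" for a using qv[OF colour] by blast
  ultimately have "coords v (phase v) = 0" by (auto simp: vec_eq_iff coords_def)
  then show "v = 0" using v(1) by (simp add: coord_space_iff)
qed

end

section \<open>Local charts: transport, and construction at the diagonal point\<close>

lemma exp_Im_Ln: "cmod w = 1 \<Longrightarrow> exp (\<i> * Im (Ln w)) = w"
proof -
  assume w: "cmod w = 1"
  then have nz: "w \<noteq> 0" by auto
  have "Re (Ln w) = 0" using w nz by (simp add: Re_Ln)
  then have "\<i> * Im (Ln w) = Ln w" by (simp add: complex_eq_iff)
  then show ?thesis using nz by simp
qed

text \<open>The condition of \<open>smooth_submanifold\<close> at a single point, isolated so that
  it can be moved between points.\<close>

definition local_chart :: "nat \<Rightarrow> 'a::euclidean_space set \<Rightarrow> 'a \<Rightarrow> bool" where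
  "local_chart d M p \<longleftrightarrow> (\<exists>U L W f g. open U \<and> p \<in> U \<and> subspace L \<and> dim L = d \<and> open W \<and>
        C_infinity_on W (f :: 'a \<Rightarrow> 'a) \<and> homeomorphism (W \<inter> L) (M \<inter> U) f g \<and>
        (\<forall>x \<in> W \<inter> L. inj_on (frechet_derivative f (at x)) L))"

text \<open>Composing the parametrisation with a linear automorphism that preserves \<open>M\<close>
  keeps \<open>L\<close> and \<open>W\<close> and changes the differential by an injective factor.
  It is applied to conjugation by a unitary matrix.\<close>

lemma local_chart_transport:
  fixes \<Phi> :: "'a::euclidean_space \<Rightarrow> 'a"
  assumes \<Phi>: "bounded_linear \<Phi>" and \<Psi>: "bounded_linear \<Psi>"
    and inv: "\<And>x. \<Psi> (\<Phi> x) = x" "\<And>x. \<Phi> (\<Psi> x) = x"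
    and M: "\<And>x. x \<in> M \<Longrightarrow> \<Phi> x \<in> M" "\<And>x. x \<in> M \<Longrightarrow> \<Psi> x \<in> M"
    and "local_chart d M p"
  shows "local_chart d M (\<Phi> p)"
proof -
  obtain U L W f g where U: "open U" "p \<in> U" and L: "subspace L" "dim L = d" and W: "open W"
    and f: "C_infinity_on W (f :: 'a \<Rightarrow> 'a)" "homeomorphism (W \<inter> L) (M \<inter> U) f g"
    "\<And>x. x \<in> W \<inter> L \<Longrightarrow> inj_on (frechet_derivative f (at x)) L"
    using assms(7) unfolding local_chart_def by blast
  have "open (\<Psi> -` U)"
    using continuous_open_vimage[OF \<open>open U\<close>, of \<Psi>] bounded_linear.isCont[OF \<Psi> continuous_ident] by auto
  moreover have "C_infinity_on W (\<lambda>x. \<Phi> (f x))"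
    by (rule C_infinity_on_bounded_linear[OF \<Phi> W f(1)])
  moreover have "homeomorphism (M \<inter> U) (M \<inter> \<Psi> -` U) \<Phi> \<Psi>"
    using M inv bounded_linear.continuous_on[OF \<Phi> continuous_on_id]
      bounded_linear.continuous_on[OF \<Psi> continuous_on_id]
    by (intro homeomorphismI) auto
  from homeomorphism_compose[OF f(2) this]
  have "homeomorphism (W \<inter> L) (M \<inter> \<Psi> -` U) (\<lambda>x. \<Phi> (f x)) (g \<circ> \<Psi>)" by (simp add: o_def)
  moreover have "inj_on (frechet_derivative (\<lambda>x. \<Phi> (f x)) (at x)) L" if x: "x \<in> W \<inter> L" for x
  proof -
    have "(f has_derivative frechet_derivative f (at x)) (at x)"
      using C_infinity_on_differentiable[OF f(1)] x frechet_derivative_works by blast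
    from frechet_derivative_at[OF bounded_linear.has_derivative[OF \<Phi> this]]
    have "frechet_derivative (\<lambda>x. \<Phi> (f x)) (at x) = (\<lambda>h. \<Phi> (frechet_derivative f (at x) h))" by simp
    then show ?thesis using f(3)[OF x] inv(1) unfolding inj_on_def by metis
  qed
  ultimately show ?thesis
    unfolding local_chart_def using U L W inv(1)
    by (intro exI[of _ "\<Psi> -` U"] exI[of _ L] exI[of _ W] exI[of _ "\<lambda>x. \<Phi> (f x)"] exI[of _ "g \<circ> \<Psi>"]) auto
qed

context flag_chart
begin

text \<open>With matching labels, the projections of two resolutions of \<open>A\<close> coincide,
  so nonvanishing and closeness carry over. This makes the resolution built into
  \<open>chart X\<close> good without estimating its flag.\<close>

lemma good_transfer:
  assumes A: "good A \<mu> E" and F: "resolution I \<nu> F A"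
    and \<nu>: "\<And>i. i \<in> {1..I} \<Longrightarrow> cmod (\<nu> i) = 1" "\<And>i. i \<in> {1..I} \<Longrightarrow> cmod (\<nu> i - l i) < \<epsilon>"
  shows "good A \<nu> F"
proof -
  have eq: "F i = E i" if "i \<in> {1..I}" for i
  proof -
    have "norm (F i - E i) \<le> 2 * real I / \<epsilon> * norm (A - A)"
      using A \<nu> eps unfolding good_def
      by (intro resolution_close[OF F _ _ _ that] eigenvalues_apart) auto
    then show ?thesis by simp
  qed
  have "(\<Sum>j=1..i. F j) = (\<Sum>j=1..i. E j)" if "i \<in> {1..I}" for i
    using that by (intro sum.cong refl eq) auto
  then show ?thesis using A F \<nu> eq unfolding good_def by (auto simp del: One_nat_def)
qed

lemma eigval_ratio:
  assumes "i \<in> {1..I}" "cmod z = 1" "cmod (z - l i) < \<epsilon>"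
  shows "cmod (z / l i) = 1" "0 < Re (z / l i)"
proof -
  have nz: "l i \<noteq> 0" using l_norm[OF assms(1)] by auto
  show "cmod (z / l i) = 1" using assms l_norm by (simp add: norm_divide)
  have "cmod (z / l i - 1) = cmod (z - l i) / cmod (l i)"
    using nz by (simp add: diff_divide_distrib flip: norm_divide)
  also have "\<dots> < 1" using assms(3) eps l_norm[OF assms(1)] by simp
  finally have "\<bar>Re (z / l i - 1)\<bar> < 1" using abs_Re_le_cmod le_less_trans by blast
  then show "0 < Re (z / l i)" by simp
qed

lemma local_chart_base:
  assumes k: "\<And>i. i \<in> {1..I} \<Longrightarrow> card {a. c a = i} = k i"
  shows "local_chart (2 * card {(a, b). c b < c a} + I) (unitary_with_multiplicities I k) base"
proof -
  define M :: "(complex^'n^'n) set" where "M = unitary_with_multiplicities I k"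
  obtain \<delta> where \<delta>: "\<delta> > 0" "\<And>A \<mu> E. resolution I \<mu> E A \<Longrightarrow> (\<And>i. i \<in> {1..I} \<Longrightarrow> cmod (\<mu> i) = 1) \<Longrightarrow>
    norm (A - base) < \<delta> \<Longrightarrow> \<exists>\<mu> E. good A \<mu> E"
    by (rule good_exists) blast
  define U where "U = ball base \<delta>"
  have ex: "\<exists>p. good A (fst p) (snd p)" if A: "A \<in> M \<inter> U" for A
  proof -
    have "A \<in> unitary_with_multiplicities I k" using A by (simp add: M_def)
    then obtain V and e :: "'n \<Rightarrow> nat" and m where V: "unitary_matrix V" "\<And>a. e a \<in> {1..I}"
      "\<And>i. i \<in> {1..I} \<Longrightarrow> cmod (m i) = 1" "A = V ** diag (\<lambda>a. m (e a)) ** adj V"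
      by (rule unitary_with_multiplicities_diagonalization) blast
    have "resolution I m (\<lambda>i. V ** proj {a. e a = i} ** adj V) A"
      unfolding V(4) by (rule resolution_conj[OF resolution_diag[OF V(2)] V(1)])
    from \<delta>(2)[OF this V(3)] show ?thesis using A by (simp add: U_def dist_norm norm_minus_commute)
  qed
  \<comment> \<open>An arbitrary choice, but \<open>good_unique\<close> and
    \<open>good_close\<close> show that its values at labels in \<open>{1..I}\<close> are determined
    by \<open>A\<close> and vary continuously.\<close>
  define dec where "dec A = (SOME p. good A (fst p) (snd p))" for A
  define ev where "ev A = fst (dec A)" for A
  define sp where "sp A = snd (dec A)" for A
  have good: "good A (ev A) (sp A)" if "A \<in> M \<inter> U" for A
    unfolding ev_def sp_def dec_def using someI_ex[OF ex[OF that]] .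
  define R where "R A j = (\<Sum>i=1..j. sp A i)" for A j
  define ang where "ang A i = Im (Ln (ev A i / l i))" for A i
  define g where "g A = coords (flag_matrix (R A)) (ang A)" for A
  \<comment> \<open>The bound by \<open>pi\<close> lets the principal logarithm recover the phase,
    excluding other angles with the same exponential; nearness to \<open>l i\<close> preserves the
    labels and makes the eigenvalues distinct.\<close>
  define W where "W = {X. chart X \<in> U \<and> (\<forall>i\<in>{1..I}. \<bar>phase X i\<bar> < pi \<and> cmod (eigval X i - l i) < \<epsilon>)}"

  have "continuous_on UNIV chart" by (rule C_infinity_on_imp_continuous_on[OF smooth_chart])
  then have "open (chart -` U)" unfolding U_def by (intro open_vimage) auto
  moreover have "open {X. \<bar>phase X i\<bar> < pi \<and> cmod (eigval X i - l i) < \<epsilon>}" for i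
    unfolding phase_def using C_infinity_on_imp_continuous_on[OF smooth_eigval[of i]]
    by (intro open_Collect_conj open_Collect_less continuous_intros) auto
  then have "open (\<Inter>i\<in>{1..I}. {X. \<bar>phase X i\<bar> < pi \<and> cmod (eigval X i - l i) < \<epsilon>})" by (intro open_INT) auto
  moreover have "W = chart -` U \<inter> (\<Inter>i\<in>{1..I}. {X. \<bar>phase X i\<bar> < pi \<and> cmod (eigval X i - l i) < \<epsilon>})"
    by (auto simp: W_def)
  ultimately have W: "open W" by (simp only: open_Int)

  have chart_M: "chart X \<in> M \<inter> U" if "X \<in> W" for X
    using that chart_mem[of X k] k unfolding W_def M_def by blast
  have chart_good: "good (chart X) (eigval X) (flag_step (mat 1 + lower X))" if "X \<in> W" for X
    by (rule good_transfer[OF good[OF chart_M[OF that]] chart_resolution norm_eigval])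
      (use that in \<open>auto simp: W_def\<close>)
  have ang_bound: "\<bar>ang A i\<bar> < pi" "l i * exp (\<i> * ang A i) = ev A i" if "A \<in> M \<inter> U" "i \<in> {1..I}" for A i
  proof -
    have w: "cmod (ev A i / l i) = 1" "0 < Re (ev A i / l i)"
      using good[OF that(1)] that(2) unfolding good_def by (intro eigval_ratio; auto)+
    then have "\<bar>ang A i\<bar> < pi / 2" unfolding ang_def by (subst Re_Ln_pos_lt) auto
    then show "\<bar>ang A i\<bar> < pi" using pi_gt_zero by linarith
    have "l i \<noteq> 0" using l_norm[OF that(2)] by auto
    then show "l i * exp (\<i> * ang A i) = ev A i" unfolding ang_def by (simp add: exp_Im_Ln[OF w(1)])
  qed
  have R: "adj (R A j) = R A j" "i \<le> j \<Longrightarrow> R A j ** R A i = R A i" "invertible (closeness (R A j) j)"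
    if "A \<in> M \<inter> U" "j \<in> {1..I}" for A i j
  proof -
    have res: "resolution I (ev A) (sp A) A" using good[OF that(1)] by (simp add: good_def)
    show "adj (R A j) = R A j" "i \<le> j \<Longrightarrow> R A j ** R A i = R A i"
      unfolding R_def using that(2) resolution_partial_sums[OF res, of j] by auto
    show "invertible (closeness (R A j) j)" using good[OF that(1)] that(2) by (simp add: good_def R_def)
  qed

  have gA: "chart (g A) = A" "g A \<in> W \<inter> coord_space" if A: "A \<in> M \<inter> U" for A
  proof -
    define N where "N = flag_matrix (R A)"
    have N: "unipotent N" unfolding N_def using R[OF A] by (intro flag_matrix_unipotent) auto
    have lower_g: "mat 1 + lower (g A) = N" unfolding g_def N_def[symmetric] by (rule lower_coords[OF N])
    \<comment> \<open>Index 0 is included because the first flag step subtracts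
      \<open>flag_proj N 0\<close>; there \<open>R A 0\<close> is an empty sum.\<close>
    have "flag_proj N j = R A j" if "j \<le> I" for j
    proof (cases "j = 0")
      case True
      then show ?thesis using flag_proj_0[OF N] by (simp add: R_def)
    next
      case False
      with that show ?thesis
        unfolding N_def by (intro flag_proj_flag_matrix R[OF A]) auto
    qed
    then have step: "flag_step N i = sp A i" if "i \<in> {1..I}" for i
      using that by (cases i) (auto simp: flag_step_def R_def)
    have eigval_g: "eigval (g A) i = ev A i" if "i \<in> {1..I}" for i
      using ang_bound(2)[OF A that] by (simp add: eigval_def g_def phase_coords[OF that])
    have "chart (g A) = (\<Sum>i=1..I. mat (ev A i) ** sp A i)"
      unfolding chart_def lower_g by (intro sum.cong) (auto simp: step eigval_g)
    also have "\<dots> = A" using good[OF A] resolutionD(5)[of I "ev A" "sp A" A] by (simp add: good_def)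
    finally show e: "chart (g A) = A" .
    have "cmod (eigval (g A) i - l i) < \<epsilon>" "\<bar>phase (g A) i\<bar> < pi" if "i \<in> {1..I}" for i
      using good[OF A] that ang_bound(1)[OF A that] eigval_g[OF that]
      by (auto simp: good_def g_def phase_coords[OF that])
    then show "g A \<in> W \<inter> coord_space"
      using A e by (auto simp: W_def g_def coords_mem)
  qed

  have gX: "g (chart X) = X" if X: "X \<in> W \<inter> coord_space" for X
  proof -
    define A where "A = chart X"
    define N where "N = mat 1 + lower X"
    have A: "A \<in> M \<inter> U" using chart_M X by (auto simp: A_def)
    have gd: "good A (eigval X) (flag_step N)" using chart_good X by (auto simp: A_def N_def)
    have eq: "sp A i = flag_step N i" "ev A i = eigval X i" if "i \<in> {1..I}" for i
      using good_unique[OF good[OF A] gd that] by auto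
    have RA: "R A j = flag_proj N j" if "j \<in> {1..I}" for j
    proof -
      have "R A j = (\<Sum>i=1..j. flag_step N i)"
        unfolding R_def using that eq(1) by (intro sum.cong) auto
      then show ?thesis unfolding N_def by (simp only: sum_flag_step[OF unipotent_lower])
    qed
    have "flag_matrix (R A) = flag_matrix (flag_proj N)"
      unfolding flag_matrix_def by (intro sum.cong refl) (simp only: RA)
    also have "\<dots> = N"
    proof (rule flag_matrix_flag_proj)
      show "unipotent N" by (simp add: N_def)
      show "invertible (closeness (flag_proj N j) j)" if "j \<in> {1..I}" for j
        using R(3)[OF A that] RA[OF that] by simp
    qed
    finally have fm: "flag_matrix (R A) = N" .
    have "ang A i = phase X i" if i: "i \<in> {1..I}" for i
    proof -
      have "l i \<noteq> 0" using l_norm[OF i] by auto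
      then have "ev A i / l i = exp (\<i> * phase X i)" by (simp add: eq(2)[OF i] eigval_def)
      moreover have "Ln (exp (\<i> * phase X i)) = \<i> * phase X i"
      proof (rule Ln_exp)
        have "\<bar>phase X i\<bar> < pi" using X i by (auto simp: W_def)
        then show "- pi < Im (\<i> * phase X i)" "Im (\<i> * phase X i) \<le> pi" by auto
      qed
      ultimately show ?thesis by (simp add: ang_def)
    qed
    then have ang: "ang A (c a) = phase X (c a)" for a using colour by blast
    have "g A = coords X (phase X)"
      by (auto simp: g_def fm vec_eq_iff coords_def ang N_def lower_def mat_def)
    also have "\<dots> = X" using X by (simp add: coord_space_iff)
    finally show ?thesis by (simp add: A_def)
  qed

  have cont_sp: "continuous_on (M \<inter> U) (\<lambda>A. sp A i)" if i: "i \<in> {1..I}" for i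
  proof (rule lipschitz_on_continuous_on[OF lipschitz_onI])
    show "dist (sp A i) (sp B i) \<le> 2 * real I / \<epsilon> * dist A B" if "A \<in> M \<inter> U" "B \<in> M \<inter> U" for A B
      using good_close[OF good[OF that(1)] good[OF that(2)] i] by (simp add: dist_norm)
    show "0 \<le> 2 * real I / \<epsilon>" using eps by simp
  qed
  have "continuous_on (M \<inter> U) (\<lambda>A. ev A i)" if i: "i \<in> {1..I}" for i
  proof -
    \<comment> \<open>Each eigenvalue is a continuous expression in \<open>A\<close> and its
      spectral projection, so continuity of the projections suffices.\<close>
    have e: "ev A i = trace (A ** sp A i) / trace (sp A i)" "trace (sp A i) \<noteq> 0" if A: "A \<in> M \<inter> U" for A
    proof -
      have res: "resolution I (ev A) (sp A) A" and "sp A i \<noteq> 0" using good[OF A] i by (auto simp: good_def)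
      then show nz: "trace (sp A i) \<noteq> 0"
        using resolutionD(1,2)[OF res i] by (intro trace_projection_nonzero)
      have "trace (A ** sp A i) = ev A i * trace (sp A i)"
        by (simp add: resolution_eigen(1)[OF res i] trace_def mat_mult_component sum_distrib_left)
      then show "ev A i = trace (A ** sp A i) / trace (sp A i)" using nz by simp
    qed
    have "continuous_on (M \<inter> U) (\<lambda>A. trace (A ** sp A i) / trace (sp A i))"
      using e(2) by (intro continuous_on_divide bounded_linear.continuous_on[OF bounded_linear_trace]
          mm.continuous_on continuous_on_id cont_sp i) auto
    then show ?thesis by (rule continuous_on_eq) (rule e(1)[symmetric])
  qed
  then have cont_ang: "continuous_on (M \<inter> U) (\<lambda>A. ang A i)" if i: "i \<in> {1..I}" for i
    unfolding ang_def
  proof (intro continuous_on_Im continuous_on_Ln' continuous_on_divide continuous_on_const)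
    fix A assume A: "A \<in> M \<inter> U"
    show "ev A i / l i \<notin> \<real>\<^sub>\<le>\<^sub>0"
      using eigval_ratio(2)[OF i, of "ev A i"] good[OF A] i by (auto simp: good_def complex_nonpos_Reals_iff)
  qed (use i l_norm[OF i] in auto)
  have cont_R: "continuous_on (M \<inter> U) (\<lambda>A. R A j)" if "j \<in> {1..I}" for j
    unfolding R_def using that by (intro continuous_on_sum cont_sp) auto
  have cont_fm: "continuous_on (M \<inter> U) (\<lambda>A. flag_matrix (R A))"
    unfolding flag_matrix_def oblique_def
  proof (intro continuous_on_sum mm.continuous_on continuous_on_const cont_R continuous_on_matrix_inv)
    fix j assume j: "j \<in> {1..I}"
    show "continuous_on (M \<inter> U) (\<lambda>A. closeness (R A j) j)"
      unfolding closeness_def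
      by (intro continuous_on_diff mm.continuous_on continuous_on_const cont_R j)
    show "invertible (closeness (R A j) j)" if "A \<in> M \<inter> U" for A using R(3)[OF that j] .
  qed auto
  have cont_g: "continuous_on (M \<inter> U) g"
    unfolding g_def coords_def
  proof (intro continuous_on_vec_lambda)
    fix a b
    show "continuous_on (M \<inter> U) (\<lambda>A. if c b < c a then flag_matrix (R A) $ a $ b
        else if a = b \<and> a = rep (c a) then complex_of_real (ang A (c a)) else 0)"
    proof (cases "c b < c a")
      case True
      then show ?thesis by (simp add: continuous_on_component cont_fm)
    next
      case lower: False
      show ?thesis
      proof (cases "a = b \<and> a = rep (c a)")
        case True
        have "continuous_on (M \<inter> U) (\<lambda>A. complex_of_real (ang A (c a)))"
          by (intro continuous_on_of_real cont_ang colour)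
        moreover have "(a = b \<and> a = rep (c a)) = True" using True by blast
        ultimately show ?thesis using lower by (simp only: if_True if_False)
      next
        case False
        then have "(a = b \<and> a = rep (c a)) = False" by blast
        then show ?thesis using lower by (simp only: if_False continuous_on_const)
      qed
    qed
  qed

  have "homeomorphism (W \<inter> coord_space) (M \<inter> U) chart g"
    using gA gX chart_M cont_g continuous_on_subset[OF C_infinity_on_imp_continuous_on[OF smooth_chart]]
    by (intro homeomorphismI) auto
  moreover have "inj_on (frechet_derivative chart (at X)) coord_space" if X: "X \<in> W \<inter> coord_space" for X
  proof (rule inj_onI)
    fix v w assume vw: "v \<in> coord_space" "w \<in> coord_space"
      "frechet_derivative chart (at X) v = frechet_derivative chart (at X) w"
    have "linear (frechet_derivative chart (at X))"
      using C_infinity_on_differentiable[OF smooth_chart] by (intro linear_frechet_derivative) auto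
    then have 1: "frechet_derivative chart (at X) (v - w) = 0" using vw(3) by (simp add: linear_diff)
    have 2: "v - w \<in> coord_space" using subspace_diff[OF subspace_coord_space vw(1,2)] .
    have "good (chart X) (eigval X) (flag_step (mat 1 + lower X))"
      using X by (intro chart_good) blast
    note gd = this[unfolded good_def sum_flag_step[OF unipotent_lower]]
    have "cmod (eigval X i - l i) < \<epsilon>" "invertible (closeness (flag_proj (mat 1 + lower X) i) i)"
      "flag_step (mat 1 + lower X) i \<noteq> 0" if "i \<in> {1..I}" for i
      using gd that by blast+
    from chart_derivative_injective[OF this 2 1] have "v - w = 0" by blast
    then show "v = w" by simp
  qed
  moreover have "base \<in> U" using \<delta>(1) by (simp add: U_def)
  moreover have "open U" by (simp add: U_def)
  moreover have "C_infinity_on W chart"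
    using smooth_chart C_infinity_on_subset W by blast
  ultimately show ?thesis
    unfolding local_chart_def M_def[symmetric]
    using W subspace_coord_space dim_coord_space by blast
qed

end

section \<open>Counting coordinates, nonemptiness and conclusion\<close>

lemma (in flag_coordinates) card_pairs:
  "(CARD('n))\<^sup>2 = (\<Sum>i=1..I. (card {a. c a = i})\<^sup>2) + 2 * card {(a, b). c b < c a}"
proof -
  define P where "P = {(a, b). c b < c a}"
  have "(\<Union>i\<in>{1..I}. {a. c a = i} \<times> {a. c a = i}) = {(a, b). c a = c b}"
    using colour by fastforce
  moreover have "card (\<Union>i\<in>{1..I}. {a. c a = i} \<times> {a. c a = i}) = (\<Sum>i=1..I. (card {a. c a = i})\<^sup>2)"
    by (subst card_UN_disjoint) (auto simp: card_cartesian_product power2_eq_square)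
  ultimately have 1: "card {(a, b). c a = c b} = (\<Sum>i=1..I. (card {a. c a = i})\<^sup>2)" by simp
  \<comment> \<open>Swapping the components matches the pairs below the blocks with those above,
    giving the factor 2.\<close>
  have 2: "card (prod.swap ` P) = card P" by (intro card_image) simp
  have "(UNIV :: ('n \<times> 'n) set) = {(a, b). c a = c b} \<union> (P \<union> prod.swap ` P)"
    by (auto simp: P_def image_iff)
  then have "CARD('n \<times> 'n) = card ({(a, b). c a = c b} \<union> (P \<union> prod.swap ` P))" by simp
  also have "\<dots> = card {(a, b). c a = c b} + (card P + card (prod.swap ` P))"
    by (subst card_Un_disjoint; (subst card_Un_disjoint)?) (auto simp: P_def)
  finally show ?thesis using 1 2 by (simp add: P_def power2_eq_square)
qed

lemma exists_colouring:
  assumes "(\<Sum>i=1..I. k i) = CARD('n::finite)"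
  obtains c :: "'n::finite \<Rightarrow> nat" where "\<And>a. c a \<in> {1..I}" "\<And>i. i \<in> {1..I} \<Longrightarrow> card {a. c a = i} = k i"
proof -
  define S where "S = Sigma {1..I} (\<lambda>i. {..<k i})"
  have "card S = CARD('n)" using assms by (simp add: S_def)
  then obtain h :: "'n \<Rightarrow> nat \<times> nat" where h: "bij_betw h UNIV S"
    using finite_same_card_bij[of "UNIV :: 'n set" S] by (auto simp: S_def)
  have "card {a. fst (h a) = i} = k i" if i: "i \<in> {1..I}" for i
  proof -
    have "h ` {a. fst (h a) = i} = {i} \<times> {..<k i}"
    proof
      show "h ` {a. fst (h a) = i} \<subseteq> {i} \<times> {..<k i}"
      proof
        fix x assume "x \<in> h ` {a. fst (h a) = i}"
        then obtain a where "x = h a" "fst (h a) = i" by blast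
        then show "x \<in> {i} \<times> {..<k i}" using bij_betw_apply[OF h, of a] by (auto simp: S_def)
      qed
      show "{i} \<times> {..<k i} \<subseteq> h ` {a. fst (h a) = i}"
      proof
        fix x assume x: "x \<in> {i} \<times> {..<k i}"
        then have "x \<in> S" using i by (auto simp: S_def)
        then obtain a where "x = h a" using h by (auto simp: bij_betw_def)
        with x show "x \<in> h ` {a. fst (h a) = i}" by auto
      qed
    qed
    moreover have "inj_on h {a. fst (h a) = i}" using h by (auto simp: bij_betw_def intro: inj_on_subset)
    ultimately show ?thesis using card_image by fastforce
  qed
  moreover have "fst (h a) \<in> {1..I}" for a using bij_betw_apply[OF h, of a] by (auto simp: S_def)
  ultimately show ?thesis using that[of "fst \<circ> h"] by simp
qed

lemma unitary_with_multiplicities_nonempty: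
  fixes k :: "nat \<Rightarrow> nat"
  assumes "\<And>i. i \<in> {1..I} \<Longrightarrow> k i > 0" "(\<Sum>i=1..I. k i) = CARD('n::finite)"
  shows "(unitary_with_multiplicities I k :: (complex^'n^'n) set) \<noteq> {}"
proof -
  obtain c :: "'n \<Rightarrow> nat" where c: "\<And>a. c a \<in> {1..I}" "\<And>i. i \<in> {1..I} \<Longrightarrow> card {a. c a = i} = k i"
    by (rule exists_colouring[OF assms(2)]) blast
  \<comment> \<open>The angles \<open>1 / i\<close> are distinct and lie in the interval from 0 to
    \<open>pi\<close>, where the cosine is injective, so these serve as eigenvalues for any
    \<open>I\<close>.\<close>
  have "inj_on (\<lambda>i. cis (1 / real i)) {1..I}"
  proof (rule inj_onI)
    fix i j assume ij: "i \<in> {1..I}" "j \<in> {1..I}" "cis (1 / real i) = cis (1 / real j)"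
    then have "1 / real i \<le> 1" "1 / real j \<le> 1" by auto
    then have "1 / real i \<le> pi" "1 / real j \<le> pi" using pi_gt3 by linarith+
    moreover have "cos (1 / real i) = cos (1 / real j)" using ij(3) by (simp add: complex_eq_iff)
    ultimately have "1 / real i = 1 / real j"
      using cos_inj_pi[of "1 / real i" "1 / real j"] by simp
    then show "i = j" by simp
  qed
  moreover have "unitary_matrix (mat 1 :: complex^'n^'n)" by (simp add: unitary_matrix_def)
  ultimately have "mat 1 ** diag (\<lambda>a. cis (1 / real (c a))) ** adj (mat 1) \<in> unitary_with_multiplicities I k"
    using c assms(1) by (intro diagonalization_imp_unitary_with_multiplicities) auto
  then show ?thesis by blast
qed

lemma exists_separation:
  fixes l :: "nat \<Rightarrow> complex"
  assumes "inj_on l {1..I}"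
  obtains \<epsilon> :: real where "\<epsilon> > 0" "\<epsilon> \<le> 1"
    "\<And>i j. i \<in> {1..I} \<Longrightarrow> j \<in> {1..I} \<Longrightarrow> i \<noteq> j \<Longrightarrow> 3 * \<epsilon> \<le> cmod (l i - l j)"
proof -
  \<comment> \<open>Inserting 1 enforces \<open>\<epsilon> \<le> 1\<close> and keeps the minimum
    meaningful when there is only one eigenvalue and hence no pair.\<close>
  define S where "S = insert 1 ((\<lambda>(i, j). cmod (l i - l j) / 3) ` {(i, j) \<in> {1..I} \<times> {1..I}. i \<noteq> j})"
  have "finite ({1..I} \<times> {1..I})" by simp
  then have "finite {(i, j) \<in> {1..I} \<times> {1..I}. i \<noteq> j}" by (rule finite_subset[rotated]) auto
  then have fin: "finite S" "S \<noteq> {}" by (auto simp: S_def)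
  have "\<forall>x\<in>S. x > 0" using inj_onD[OF assms] by (fastforce simp: S_def)
  then have "Min S > 0" using fin by simp
  moreover have "Min S \<le> 1" using fin by (intro Min_le) (auto simp: S_def)
  moreover have "3 * Min S \<le> cmod (l i - l j)" if "i \<in> {1..I}" "j \<in> {1..I}" "i \<noteq> j" for i j
  proof -
    have "Min S \<le> cmod (l i - l j) / 3" using fin(1) that by (intro Min_le) (auto simp: S_def)
    then show ?thesis by simp
  qed
  ultimately show ?thesis using that by blast
qed

theorem corollary2p4:
  fixes k :: "nat \<Rightarrow> nat" and I :: nat
  assumes "\<forall>i\<in>{1..I}. k i > 0"
    and "(\<Sum>i=1..I. k i) = CARD('n::finite)"
  shows "has_real_dimension
           (unitary_with_multiplicities I k :: (complex ^ 'n ^ 'n) set)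
           (CARD('n)\<^sup>2 - (\<Sum>i=1..I. ((k i)\<^sup>2 - 1)))"
proof -
  define M :: "(complex^'n^'n) set" where "M = unitary_with_multiplicities I k"
  define d where "d = CARD('n)\<^sup>2 - (\<Sum>i=1..I. ((k i)\<^sup>2 - 1))"
  have k: "k i > 0" if "i \<in> {1..I}" for i using assms(1) that by blast
  have "local_chart d M p" if p: "p \<in> M" for p
  proof -
    obtain V and c :: "'n \<Rightarrow> nat" and l where V: "unitary_matrix V" and c: "\<And>a. c a \<in> {1..I}"
      "\<And>i. i \<in> {1..I} \<Longrightarrow> card {a. c a = i} = k i" and l: "inj_on l {1..I}"
      "\<And>i. i \<in> {1..I} \<Longrightarrow> cmod (l i) = 1" and pV: "p = V ** diag (\<lambda>a. l (c a)) ** adj V"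
      using unitary_with_multiplicities_diagonalization[OF p[unfolded M_def]] by blast
    obtain \<epsilon> :: real where \<epsilon>: "\<epsilon> > 0" "\<epsilon> \<le> 1"
      "\<And>i j. i \<in> {1..I} \<Longrightarrow> j \<in> {1..I} \<Longrightarrow> i \<noteq> j \<Longrightarrow> 3 * \<epsilon> \<le> cmod (l i - l j)"
      by (rule exists_separation[OF l(1)]) blast
    interpret flag_chart I c l \<epsilon>
    proof
      show "\<exists>a. c a = i" if "i \<in> {1..I}" for i
        using c(2)[OF that] k[OF that] by (metis (mono_tags, lifting) card.empty empty_Collect_eq less_irrefl)
    qed (use c(1) l(2) \<epsilon> in auto)
    \<comment> \<open>Positivity of \<open>k i\<close> makes the truncated subtraction in
      \<open>(k i)\<^sup>2 - 1\<close> exact; the \<open>I\<close> ones split off here are the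
      phases of the eigenvalues.\<close>
    have "(\<Sum>i=1..I. (card {a. c a = i})\<^sup>2) = (\<Sum>i=1..I. ((k i)\<^sup>2 - 1)) + (\<Sum>i=1..I. 1)"
      unfolding sum.distrib[symmetric]
      using c(2) k by (intro sum.cong) auto
    also have "\<dots> = (\<Sum>i=1..I. ((k i)\<^sup>2 - 1)) + I" by simp
    finally have d: "d = 2 * card {(a, b). c b < c a} + I"
      using card_pairs by (simp add: d_def)
    have "local_chart d M (V ** base ** adj V)"
    proof (rule local_chart_transport[where \<Phi>="\<lambda>X. V ** X ** adj V" and \<Psi>="\<lambda>X. adj V ** X ** V"])
      show "bounded_linear (\<lambda>X. V ** X ** adj V)" "bounded_linear (\<lambda>X. adj V ** X ** V)"
        by (intro bounded_linear_compose[OF mm.bounded_linear_left mm.bounded_linear_right])+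
      show "V ** X ** adj V \<in> M" "adj V ** X ** V \<in> M" if "X \<in> M" for X
        using unitary_with_multiplicities_conj[OF k V] that
          unitary_with_multiplicities_conj[OF k unitary_matrix_adj[OF V]] by (auto simp: M_def)
      show "local_chart d M base" unfolding d M_def by (rule local_chart_base[OF c(2)])
    qed (simp_all add: mm_assoc unitary_matrix_cancel[OF V] unitary_matrix_mult[OF V])
    then show ?thesis by (simp add: pV base_def)
  qed
  then have "smooth_submanifold d M"
    unfolding smooth_submanifold_def local_chart_def by blast
  moreover have "M \<noteq> {}" unfolding M_def by (rule unitary_with_multiplicities_nonempty[OF k assms(2)])
  ultimately show ?thesis unfolding has_real_dimension_def M_def d_def by blast
qed

end
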